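(* Let $X$ be a homogeneous tree of degree $q+1$, $q\ge 2$, let $\alpha\in(0,2)$, and let $p_t(x)$ be the $\alpha$-stable kernel on $X$, i.e. the convolution kernel of $e^{-t\Delta^{\alpha/2}}$. For any constants $K,M>0$, $$p_t(x)\asymp \phi_0(x)\,t^{-3/2}\exp\bigl(-t(1-\gamma)^{\alpha/2}\bigr)\qquad\text{for } |x|<Kt^{1/2},\ t\ge 1,$$ and $$p_t(x)\asymp \phi_0(x)\,t\,|x|^{-2-\alpha/2}\,q^{-|x|/2}\qquad\text{for } |x|>Mt^{2/\alpha}>0 .$$
   Context: $X$ is (the vertex set of) the homogeneous tree of degree $q+1$ with $q\ge 2$, with its graph distance $d$, counting measure and a fixed reference vertex $o$; $|x|=d(x,o)$. The nearest-neighbour Laplacian is $\Delta f(x)=f(x)-\frac1{q+1}\sum_{y\sim x}f(y)$, the heat semigroup is $\mathcal H_t=e^{-t\Delta}$, and $h_t(x)$ denotes its (radial) heat kernel, i.e. $h_t(x)=(e^{-t\Delta}\delta_o)(x)$. Set $\gamma=\frac{2\sqrt q}{q+1}$, so that $1-\gamma$ is the bottom of the spectrum of $\Delta$ on $L^2(X)$, and let $\phi_0(x)=\left(1+\frac{q-1}{q+1}|x|\right)q^{-|x|/2}$ be the spherical function. For $t>0$, $\eta_t$ is the function on $(0,\infty)$ determined by its Laplace transform $\int_0^\infty e^{-\lambda u}\eta_t(u)\,du=e^{-t\lambda^{\alpha/2}}$, $\lambda\ge0$. The subordinate semigroup is $e^{-t\Delta^{\alpha/2}}=\int_0^\infty e^{-u\Delta}\eta_t(u)\,du$,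 with kernel $p_t(x)=\int_0^\infty h_u(x)\eta_t(u)\,du$. $f\asymp g$ on a given region means that there is a constant $c>0$ (independent of $x$ and $t$ in the region) such that $c^{-1}<f/g<c$ there. *)

theory Defs
  imports "HOL-Analysis.Analysis"
begin

text \<open>
  A graph is given by its adjacency relation; the vertex set is the whole type.
\<close>

definition simple_graph :: "('a \<Rightarrow> 'a \<Rightarrow> bool) \<Rightarrow> bool" where
  "simple_graph E \<longleftrightarrow> symp E \<and> irreflp E"

definition connected_graph :: "('a \<Rightarrow> 'a \<Rightarrow> bool) \<Rightarrow> bool" where
  "connected_graph E \<longleftrightarrow> (\<forall>x y. E\<^sup>*\<^sup>* x y)"

text \<open>
  A cycle is listed without repeating its starting point; the length bound rules
  out a single edge traversed back and forth.
\<close>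

definition is_cycle :: "('a \<Rightarrow> 'a \<Rightarrow> bool) \<Rightarrow> 'a list \<Rightarrow> bool" where
  "is_cycle E vs \<longleftrightarrow>
     length vs \<ge> 3 \<and> distinct vs \<and>
     (\<forall>i. Suc i < length vs \<longrightarrow> E (vs ! i) (vs ! Suc i)) \<and> E (last vs) (hd vs)"

definition neighbours :: "('a \<Rightarrow> 'a \<Rightarrow> bool) \<Rightarrow> 'a \<Rightarrow> 'a set" where
  "neighbours E x = {y. E x y}"

definition homogeneous_tree :: "nat \<Rightarrow> ('a \<Rightarrow> 'a \<Rightarrow> bool) \<Rightarrow> bool" where
  "homogeneous_tree q E \<longleftrightarrow>
     simple_graph E \<and> connected_graph E \<and> (\<nexists>vs. is_cycle E vs) \<and>
     (\<forall>x. finite (neighbours E x) \<and> card (neighbours E x) = q + 1)"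

text \<open>
  The relational power \<open>E ^^ n\<close> relates the endpoints of walks of length \<open>n\<close>.
\<close>

definition graph_dist :: "('a \<Rightarrow> 'a \<Rightarrow> bool) \<Rightarrow> 'a \<Rightarrow> 'a \<Rightarrow> nat" where
  "graph_dist E x y = (LEAST n. (E ^^ n) x y)"

definition laplacian :: "nat \<Rightarrow> ('a \<Rightarrow> 'a \<Rightarrow> bool) \<Rightarrow> ('a \<Rightarrow> real) \<Rightarrow> 'a \<Rightarrow> real" where
  "laplacian q E f x = f x - (1 / (real q + 1)) * (\<Sum>y\<in>neighbours E x. f y)"

text \<open>
  The Laplacian is a bounded operator on every \<open>\<ell>\<^sup>p\<close>, so its semigroup is the operator
  exponential; the power series converges in operator norm, hence pointwise.
\<close>

definition heat_semigroup ::
    "nat \<Rightarrow> ('a \<Rightarrow> 'a \<Rightarrow> bool) \<Rightarrow> real \<Rightarrow> ('a \<Rightarrow> real) \<Rightarrow> 'a \<Rightarrow> real" where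
  "heat_semigroup q E t f x = (\<Sum>n. (- t) ^ n / fact n * (laplacian q E ^^ n) f x)"

definition heat_kernel ::
    "nat \<Rightarrow> ('a \<Rightarrow> 'a \<Rightarrow> bool) \<Rightarrow> 'a \<Rightarrow> real \<Rightarrow> 'a \<Rightarrow> real" where
  "heat_kernel q E x0 t = heat_semigroup q E t (indicator {x0})"

text \<open>
  \<open>stable_density \<alpha> t f\<close>: on \<open>(0, \<infinity>)\<close>, \<open>f\<close> has the Laplace transform
  \<open>exp (- t \<lambda>\<^bsup>\<alpha>/2\<^esup>)\<close>. This determines \<open>f\<close> almost everywhere on \<open>(0, \<infinity>)\<close>. At \<open>\<lambda> = 0\<close> the
  right-hand side is \<open>1\<close>, since \<open>0 powr a = 0\<close>.
\<close>

definition stable_density :: "real \<Rightarrow> real \<Rightarrow> (real \<Rightarrow> real) \<Rightarrow> bool" where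
  "stable_density \<alpha> t f \<longleftrightarrow>
     (\<forall>l\<ge>0. set_integrable lborel {0<..} (\<lambda>u. exp (- l * u) * f u) \<and>
            (LBINT u:{0<..}. exp (- l * u) * f u) = exp (- t * l powr (\<alpha> / 2)))"

definition stable_kernel ::
    "nat \<Rightarrow> ('a \<Rightarrow> 'a \<Rightarrow> bool) \<Rightarrow> 'a \<Rightarrow> (real \<Rightarrow> real \<Rightarrow> real) \<Rightarrow> real \<Rightarrow> 'a \<Rightarrow> real" where
  "stable_kernel q E x0 \<eta> t x = (LBINT u:{0<..}. heat_kernel q E x0 u x * \<eta> t u)"

definition tree_gamma :: "nat \<Rightarrow> real" where
  "tree_gamma q = 2 * sqrt (real q) / (real q + 1)"

definition spherical0 :: "nat \<Rightarrow> ('a \<Rightarrow> 'a \<Rightarrow> bool) \<Rightarrow> 'a \<Rightarrow> 'a \<Rightarrow> real" where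
  "spherical0 q E x0 x =
     (1 + (real q - 1) / (real q + 1) * real (graph_dist E x0 x)) *
     real q powr (- real (graph_dist E x0 x) / 2)"

definition comparable_on :: "'b set \<Rightarrow> ('b \<Rightarrow> real) \<Rightarrow> ('b \<Rightarrow> real) \<Rightarrow> bool" where
  "comparable_on R f g \<longleftrightarrow> (\<exists>c>0. \<forall>z\<in>R. inverse c < f z / g z \<and> f z / g z < c)"

end

theory Submission
  imports Defs "HOL-Probability.Probability" "HOL-Real_Asymp.Real_Asymp"
begin

text \<open>
  Let \<open>A = 1 - \<Delta>\<close> be the averaging operator and \<open>a = \<alpha> / 2\<close>. Integrating
  \<open>e\<^bsup>-u\<Delta>\<^esup> = e\<^bsup>-u\<^esup> \<Sum>\<^sub>m u\<^bsup>m\<^esup>/m! A\<^bsup>m\<^esup>\<close> against \<open>\<eta>\<^sub>t\<close> gives \<open>p\<^sub>t = \<Sum>\<^sub>m B\<^sub>t(m) A\<^bsup>m\<^esup>\<delta>\<close>, where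
  \<open>\<Sum>\<^sub>m B\<^sub>t(m) z\<^bsup>m\<^esup> = exp (- t (1 - z)\<^bsup>a\<^esup>)\<close>. Only the Laplace transform of \<open>\<eta>\<^sub>t\<close> enters, so no
  positivity or uniqueness of \<open>\<eta>\<^sub>t\<close> has to be established. Differentiating the generating function
  gives a recursion for \<open>B\<^sub>t\<close>, which shows \<open>B\<^sub>t \<ge> 0\<close>, \<open>B\<^sub>t(m) \<le> D t m\<^bsup>-1-a\<^esup>\<close>, and a matching lower
  bound when \<open>t m\<^bsup>-a\<^esup>\<close> is bounded.

  Far from the root the terms with \<open>m < |x|\<close> vanish, and \<open>\<Sum>\<^sub>m A\<^bsup>m\<^esup>\<delta>(x)\<close> is the Green function, of
  order \<open>q\<^bsup>-|x|\<^esup>\<close> and mostly collected at times \<open>m < C |x|\<close>; hence \<open>p\<^sub>t(x)\<close> is comparable with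
  \<open>t |x|\<^bsup>-1-a\<^esup> q\<^bsup>-|x|\<^esup>\<close>.

  Near the root, \<open>q\<^bsup>n/2\<^esup> (p\<^sub>t(n) - p\<^sub>t(n+2))\<close> is the \<open>n\<close>-th sine coefficient of
  \<open>exp (- t (1 - \<gamma> cos s)\<^bsup>a\<^esup>)\<close>, which Laplace's method shows to be of order
  \<open>(n+1) t\<^bsup>-3/2\<^esup> exp (- t (1 - \<gamma>)\<^bsup>a\<^esup>)\<close>; summing over \<open>n, n+2, n+4, \<dots>\<close> recovers \<open>p\<^sub>t(n)\<close>.
\<close>

section \<open>Distance to the root in a homogeneous tree\<close>

text \<open>Two arguments are needed because each loses its grip in the other's region. The sine
  coefficient is an oscillating integral: after rescaling, its main term has size exp(-k^2/2) with k
  = (n+1)/r and r of order sqrt t, while the error is small only in absolute terms, so the lower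
  bound survives only while k stays bounded. Far out all terms are nonnegative and nothing cancels,
  but the power law of B_t(m) holds from below only while t m^(-a) is bounded, which is the
  condition |x| > M t^(1/a). Differences p(n) - p(n+2) are taken because the spectral formula for p
  itself carries a nonconstant Plancherel density, whereas the differences leave plain sines. The
  walk is bipartite, yet 1 - gamma cos s is largest at s = pi, so s = 0 is the only peak. Since
  phi_0(x) is comparable with |x| q^(-|x|/2) away from the root, the exponent -1-a of the kernel
  appears as -2-a in the statement.\<close>

context
  fixes q :: nat and E :: "'a \<Rightarrow> 'a \<Rightarrow> bool" and x0 :: 'a
  assumes tree: "homogeneous_tree q E"
begin

lemma edge_sym: "E x y \<Longrightarrow> E y x"
  using tree unfolding homogeneous_tree_def simple_graph_def by (meson sympD)

lemma edge_irrefl: "\<not> E x x"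
  using tree unfolding homogeneous_tree_def simple_graph_def by (meson irreflpD)

lemma no_cycle: "\<not> is_cycle E vs"
  using tree unfolding homogeneous_tree_def by blast

lemma graph_dist_walk: "(E ^^ graph_dist E x0 x) x0 x"
proof -
  have "E\<^sup>*\<^sup>* x0 x"
    using tree unfolding homogeneous_tree_def connected_graph_def by blast
  then have "\<exists>n. (E ^^ n) x0 x"
    by (simp add: rtranclp_is_Sup_relpowp)
  then show ?thesis
    unfolding graph_dist_def by (rule LeastI_ex)
qed

lemma graph_dist_le: "(E ^^ n) x0 x \<Longrightarrow> graph_dist E x0 x \<le> n"
  unfolding graph_dist_def by (rule Least_le)

lemma graph_dist_0_iff: "graph_dist E x0 x = 0 \<longleftrightarrow> x = x0"
  using graph_dist_walk[of x] graph_dist_le[of 0 x] by auto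

lemma graph_dist_edge_le: "E x y \<Longrightarrow> graph_dist E x0 y \<le> Suc (graph_dist E x0 x)"
  using graph_dist_walk[of x] by (intro graph_dist_le) auto

lemma parent_exists:
  assumes "graph_dist E x0 x = Suc n"
  shows "\<exists>y. E x y \<and> graph_dist E x0 y = n"
proof -
  have "(E ^^ Suc n) x0 x"
    using graph_dist_walk[of x] assms by simp
  then obtain y where y: "(E ^^ n) x0 y" "E y x"
    by auto
  have "graph_dist E x0 y \<le> n"
    using y(1) by (rule graph_dist_le)
  moreover have "Suc n \<le> Suc (graph_dist E x0 y)"
    using graph_dist_edge_le[OF y(2)] assms by simp
  ultimately show ?thesis
    using edge_sym[OF y(2)] by (intro exI[of _ y]) simp
qed

text \<open>Follow geodesics from both vertices towards the root until they meet.\<close>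

lemma path_below:
  assumes "graph_dist E x0 y = n" "graph_dist E x0 z = n" "y \<noteq> z"
  shows "\<exists>vs. distinct vs \<and> 3 \<le> length vs \<and> hd vs = y \<and> last vs = z \<and> successively E vs
            \<and> (\<forall>v\<in>set vs. graph_dist E x0 v \<le> n)"
  using assms
proof (induction n arbitrary: y z)
  case 0
  then show ?case using graph_dist_0_iff by metis
next
  case (Suc n)
  obtain y' z' where y': "E y y'" "graph_dist E x0 y' = n" and z': "E z z'" "graph_dist E x0 z' = n"
    using parent_exists[OF Suc.prems(1)] parent_exists[OF Suc.prems(2)] by blast
  show ?case
  proof (cases "y' = z'")
    case True
    have "y \<noteq> y'" "y' \<noteq> z"
      using Suc.prems(1,2) y'(2) by (metis n_not_Suc_n)+
    moreover have "E y' z"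
      using edge_sym[OF z'(1)] True by simp
    moreover have "graph_dist E x0 y' \<le> Suc n"
      using y'(2) by simp
    ultimately show ?thesis
      by (intro exI[of _ "[y, y', z]"]) (simp add: Suc.prems y'(1))
  next
    case False
    then obtain vs where vs: "distinct vs" "3 \<le> length vs" "hd vs = y'" "last vs = z'"
        "successively E vs" "\<forall>v\<in>set vs. graph_dist E x0 v \<le> n"
      using Suc.IH[OF y'(2) z'(2) False] by blast
    have "vs \<noteq> []" using vs(2) by auto
    have "successively E (y # vs @ [z])"
      using vs \<open>vs \<noteq> []\<close> y' z' edge_sym by (auto simp: successively_append_iff successively_Cons)
    moreover have "distinct (y # vs @ [z])"
    proof -
      have "y \<notin> set vs" "z \<notin> set vs"
        using vs(6) Suc.prems by auto
      then show ?thesis using vs(1) Suc.prems(3) by simp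
    qed
    ultimately show ?thesis
      using vs Suc.prems \<open>vs \<noteq> []\<close> by (intro exI[of _ "y # vs @ [z]"]) (auto intro: le_SucI)
  qed
qed

lemma is_cycleI:
  "distinct vs \<Longrightarrow> 3 \<le> length vs \<Longrightarrow> successively E vs \<Longrightarrow> E (last vs) (hd vs) \<Longrightarrow> is_cycle E vs"
  unfolding is_cycle_def successively_conv_nth by blast

text \<open>An edge inside a sphere would close the path of \<open>path_below\<close> into a
  cycle.\<close>

lemma graph_dist_edge_neq:
  assumes "E y z" shows "graph_dist E x0 y \<noteq> graph_dist E x0 z"
proof
  assume eq: "graph_dist E x0 y = graph_dist E x0 z"
  have "y \<noteq> z" using assms edge_irrefl by auto
  then show False
    using path_below[OF eq refl] is_cycleI no_cycle edge_sym[OF assms] by metis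
qed

text \<open>Two parents would be joined by a path that stays within distance n. The vertex x lies
  further out, so it is not on that path and closes it into a cycle; this is why
  \<open>path_below\<close> carries a bound on the distances.\<close>

lemma parent_unique:
  assumes "E x y" "E x z" "graph_dist E x0 x = Suc n"
    and "graph_dist E x0 y = n" "graph_dist E x0 z = n"
  shows "y = z"
proof (rule ccontr)
  assume "y \<noteq> z"
  then obtain vs where vs: "distinct vs" "3 \<le> length vs" "hd vs = y" "last vs = z"
      "successively E vs" "\<forall>v\<in>set vs. graph_dist E x0 v \<le> n"
    using path_below[OF assms(4,5)] by blast
  have "vs \<noteq> []" using vs(2) by auto
  have "is_cycle E (vs @ [x])"
    using vs \<open>vs \<noteq> []\<close> assms edge_sym by (intro is_cycleI) (auto simp: successively_append_iff)
  then show False using no_cycle by blast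
qed

lemma graph_dist_edge_cases:
  assumes "E x y"
  shows "graph_dist E x0 y = Suc (graph_dist E x0 x) \<or> graph_dist E x0 x = Suc (graph_dist E x0 y)"
  using graph_dist_edge_le[OF assms] graph_dist_edge_le[OF edge_sym[OF assms]]
    graph_dist_edge_neq[OF assms] by linarith

lemma finite_neighbours: "finite (neighbours E x)"
  and card_neighbours: "card (neighbours E x) = q + 1"
  using tree unfolding homogeneous_tree_def by auto

lemma sum_neighbours_root:
  "(\<Sum>y\<in>neighbours E x0. f (graph_dist E x0 y)) = (real q + 1) * f 1"
proof -
  have "graph_dist E x0 y = 1" if "y \<in> neighbours E x0" for y
    using graph_dist_edge_cases[of x0 y] that graph_dist_0_iff[of x0] unfolding neighbours_def by auto
  then have "(\<Sum>y\<in>neighbours E x0. f (graph_dist E x0 y)) = (\<Sum>y\<in>neighbours E x0. f 1)"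
    by (intro sum.cong) auto
  then show ?thesis
    by (simp add: card_neighbours)
qed

lemma sum_neighbours_Suc:
  fixes f :: "nat \<Rightarrow> real"
  assumes "graph_dist E x0 x = Suc n"
  shows "(\<Sum>y\<in>neighbours E x. f (graph_dist E x0 y)) = f n + real q * f (Suc (Suc n))"
proof -
  obtain p where p: "E x p" "graph_dist E x0 p = n"
    using parent_exists[OF assms] by blast
  have pn: "p \<in> neighbours E x"
    using p by (simp add: neighbours_def)
  have "graph_dist E x0 y = Suc (Suc n)" if "y \<in> neighbours E x - {p}" for y
    using graph_dist_edge_cases[of x y] that assms parent_unique[of x y p n] p
    unfolding neighbours_def by auto
  then have "(\<Sum>y\<in>neighbours E x - {p}. f (graph_dist E x0 y)) = (\<Sum>y\<in>neighbours E x - {p}. f (Suc (Suc n)))"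
    by (intro sum.cong) auto
  also have "\<dots> = real q * f (Suc (Suc n))"
    using card_neighbours[of x] finite_neighbours[of x] pn by simp
  finally show ?thesis
    using sum.remove[OF finite_neighbours[of x] pn, of "\<lambda>y. f (graph_dist E x0 y)"] p by simp
qed

end

section \<open>The radial random walk\<close>

text \<open>Radial form of the averaging operator A: a vertex other than the root has one parent and
  q children, and the root has q + 1 children.\<close>

definition avg :: "nat \<Rightarrow> (nat \<Rightarrow> real) \<Rightarrow> nat \<Rightarrow> real" where
  "avg q f n = (case n of 0 \<Rightarrow> f 1 | Suc m \<Rightarrow> (f m + real q * f (Suc (Suc m))) / (real q + 1))"

lemma avg_0 [simp]: "avg q f 0 = f 1"
  and avg_Suc [simp]: "avg q f (Suc n) = (f n + real q * f (Suc (Suc n))) / (real q + 1)"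
  by (simp_all add: avg_def)

lemma avg_diff: "avg q (\<lambda>n. f n - g n) n = avg q f n - avg q g n"
  by (cases n) (simp_all add: diff_divide_distrib[symmetric] algebra_simps)

lemma avg_cmult: "avg q (\<lambda>n. c * f n) n = c * avg q f n"
  by (cases n) (simp_all add: algebra_simps)

lemma avg_sum: "avg q (\<lambda>n. \<Sum>i\<in>I. f i n) n = (\<Sum>i\<in>I. avg q (f i) n)"
  by (cases n) (simp_all add: sum.distrib sum_distrib_left sum_divide_distrib[symmetric])

lemma avg_mono: "(\<And>n. f n \<le> g n) \<Longrightarrow> avg q f n \<le> avg q g n"
  by (cases n) (auto intro!: divide_right_mono add_mono mult_left_mono)

lemma avg_pow_mono: "(\<And>n. f n \<le> g n) \<Longrightarrow> (avg q ^^ m) f n \<le> (avg q ^^ m) g n"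
  by (induction m arbitrary: n) (auto intro: avg_mono)

lemma avg_pow_cmult: "(avg q ^^ m) (\<lambda>n. c * f n) n = c * (avg q ^^ m) f n"
proof (induction m arbitrary: n)
  case (Suc m)
  have "(avg q ^^ m) (\<lambda>n. c * f n) = (\<lambda>n. c * (avg q ^^ m) f n)"
    using Suc by blast
  then show ?case by (simp add: avg_cmult)
qed simp

lemma avg_pow_eigen:
  assumes "\<And>n. avg q f n = c * f n"
  shows "(avg q ^^ m) f n = c ^ m * f n"
proof (induction m arbitrary: n)
  case (Suc m)
  have "(avg q ^^ m) f = (\<lambda>n. c ^ m * f n)"
    using Suc by blast
  then show ?case by (simp add: avg_cmult assms)
qed simp

text \<open>The probability of being at one given vertex at distance \<open>n\<close> after \<open>m\<close> steps, not the
  probability of the whole sphere.\<close>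

definition walk :: "nat \<Rightarrow> nat \<Rightarrow> nat \<Rightarrow> real" where
  "walk q m = (avg q ^^ m) (\<lambda>n. if n = 0 then 1 else 0)"

lemma walk_0: "walk q 0 n = (if n = 0 then 1 else 0)"
  by (simp add: walk_def)

lemma walk_Suc: "walk q (Suc m) = avg q (walk q m)"
  by (simp add: walk_def)

lemma walk_nonneg: "0 \<le> walk q m n"
proof (induction m arbitrary: n)
  case (Suc m)
  then show ?case by (cases n) (auto simp: walk_Suc)
qed (simp add: walk_0)

lemma walk_le_1: "walk q m n \<le> 1"
proof (induction m arbitrary: n)
  case (Suc m)
  have "walk q m i + real q * walk q m j \<le> 1 + real q * 1" for i j
    by (intro add_mono mult_left_mono Suc) auto
  then show ?case using Suc by (cases n) (auto simp: walk_Suc divide_le_eq add.commute)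
qed (simp add: walk_0)

lemma walk_eq_0: "m < n \<Longrightarrow> walk q m n = 0"
proof (induction m arbitrary: n)
  case (Suc m)
  then show ?case by (cases n) (auto simp: walk_Suc)
qed (simp add: walk_0)

lemma walk_diag_pos: "0 < walk q n n"
proof (induction n)
  case (Suc n)
  then show ?case by (auto simp: walk_Suc walk_eq_0)
qed (simp add: walk_0)

lemma laplacian_radial:
  assumes "homogeneous_tree q E"
  shows "laplacian q E (\<lambda>x. f (graph_dist E x0 x)) =
         (\<lambda>x. f (graph_dist E x0 x) - avg q f (graph_dist E x0 x))"
proof
  fix x
  show "laplacian q E (\<lambda>x. f (graph_dist E x0 x)) x = f (graph_dist E x0 x) - avg q f (graph_dist E x0 x)"
  proof (cases "graph_dist E x0 x")
    case 0
    then have "x = x0" using graph_dist_0_iff[OF assms] by metis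
    then show ?thesis
      using 0 sum_neighbours_root[OF assms, of f x0] by (simp add: laplacian_def)
  next
    case (Suc n)
    then show ?thesis
      using sum_neighbours_Suc[OF assms Suc, of f] by (simp add: laplacian_def)
  qed
qed

lemma laplacian_pow_radial:
  assumes "homogeneous_tree q E"
  shows "(laplacian q E ^^ k) (\<lambda>x. f (graph_dist E x0 x)) =
         (\<lambda>x. ((\<lambda>g n. g n - avg q g n) ^^ k) f (graph_dist E x0 x))"
  by (induction k) (simp_all add: laplacian_radial[OF assms])

text \<open>Binomial theorem for the commuting operators 1 and A, proved by Pascal's rule.\<close>

lemma id_minus_avg_pow:
  "((\<lambda>g n. g n - avg q g n) ^^ k) f n = (\<Sum>i\<le>k. real (k choose i) * (- 1) ^ i * (avg q ^^ i) f n)"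
proof (induction k arbitrary: n)
  case (Suc k)
  define F where "F = (\<lambda>i. (- 1) ^ i * (avg q ^^ i) f n)"
  have "((\<lambda>g n. g n - avg q g n) ^^ k) f = (\<lambda>n. \<Sum>i\<le>k. real (k choose i) * (- 1) ^ i * (avg q ^^ i) f n)"
    using Suc by blast
  then have "((\<lambda>g n. g n - avg q g n) ^^ Suc k) f n
      = (\<Sum>i\<le>k. real (k choose i) * F i) + (\<Sum>i\<le>k. real (k choose i) * F (Suc i))"
    by (simp add: avg_sum avg_cmult F_def sum_negf mult.assoc)
  \<comment> \<open>The index is shifted without changing its range, because
    \<open>k choose Suc k\<close> is zero.\<close>
  also have "(\<Sum>i\<le>k. real (k choose i) * F i) = F 0 + (\<Sum>i\<le>k. real (k choose Suc i) * F (Suc i))"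
  proof -
    have "(\<Sum>i\<le>k. real (k choose i) * F i) = (\<Sum>i\<le>Suc k. real (k choose i) * F i)"
      by simp
    also have "\<dots> = F 0 + (\<Sum>i\<le>k. real (k choose Suc i) * F (Suc i))"
      by (subst sum.atMost_Suc_shift) simp
    finally show ?thesis .
  qed
  also have "F 0 + (\<Sum>i\<le>k. real (k choose Suc i) * F (Suc i)) + (\<Sum>i\<le>k. real (k choose i) * F (Suc i))
      = F 0 + (\<Sum>i\<le>k. real (Suc k choose Suc i) * F (Suc i))"
    by (simp add: sum.distrib[symmetric] algebra_simps)
  also have "\<dots> = (\<Sum>i\<le>Suc k. real (Suc k choose i) * F i)"
    by (subst sum.atMost_Suc_shift) simp
  finally show ?case by (simp add: F_def mult.assoc)
qed simp

text \<open>Since 1 and A commute, exp(-u(1 - A)) = exp(-u) exp(uA). The factorisation appears as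
  the Cauchy product of the series \<open>a\<close> and \<open>b\<close>.\<close>

lemma heat_kernel_poisson:
  assumes "homogeneous_tree q E"
  shows "(\<lambda>m. exp (- u) * u ^ m / fact m * walk q m (graph_dist E x0 x)) sums heat_kernel q E x0 u x"
proof -
  define n where "n = graph_dist E x0 x"
  define a where "a = (\<lambda>m. u ^ m / fact m * walk q m n)"
  define b where "b = (\<lambda>m. (- u) ^ m / fact m)"
  have ind: "indicator {x0} = (\<lambda>x. (if graph_dist E x0 x = 0 then 1 else 0 :: real))"
    by (auto simp: graph_dist_0_iff[OF assms] indicator_def)
  have a: "summable (\<lambda>m. norm (a m))"
  proof (rule summable_comparison_test)
    have "norm (norm (a m)) \<le> \<bar>u\<bar> ^ m / fact m" for m
    proof -
      have "norm (norm (a m)) = \<bar>u\<bar> ^ m / fact m * walk q m n"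
        using walk_nonneg[of q m n] by (simp add: a_def abs_mult power_abs)
      also have "\<dots> \<le> \<bar>u\<bar> ^ m / fact m * 1"
        by (intro mult_left_mono walk_le_1) auto
      finally show ?thesis by simp
    qed
    then show "\<exists>N. \<forall>m\<ge>N. norm (norm (a m)) \<le> \<bar>u\<bar> ^ m / fact m" by blast
    show "summable (\<lambda>m. \<bar>u\<bar> ^ m / fact m)"
      using summable_exp[of "\<bar>u\<bar>"] by (simp add: field_simps)
  qed
  have b: "summable (\<lambda>m. norm (b m))"
    using summable_exp[of "\<bar>u\<bar>"] by (simp add: field_simps b_def power_abs)
  have bs: "b sums exp (- u)"
    using exp_converges[of "- u"] by (simp add: b_def scaleR_conv_of_real field_simps)
  have "(- u) ^ k / fact k * (laplacian q E ^^ k) (indicator {x0}) x = (\<Sum>i\<le>k. a i * b (k - i))" for k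
  proof -
    have "(laplacian q E ^^ k) (indicator {x0}) x
        = (\<Sum>i\<le>k. real (k choose i) * (- 1) ^ i * walk q i n)"
      unfolding ind laplacian_pow_radial[OF assms, where f="\<lambda>n. if n = 0 then 1 else 0"] id_minus_avg_pow walk_def n_def ..
    then have "(- u) ^ k / fact k * (laplacian q E ^^ k) (indicator {x0}) x
        = (\<Sum>i\<le>k. (- u) ^ k / fact k * (real (k choose i) * (- 1) ^ i * walk q i n))"
      by (simp add: sum_distrib_left)
    also have "\<dots> = (\<Sum>i\<le>k. a i * b (k - i))"
    proof (rule sum.cong)
      fix i assume "i \<in> {..k}"
      then have i: "i \<le> k" by simp
      have "(- u) ^ k = (- u) ^ i * (- u) ^ (k - i)"
        using i by (simp add: power_add[symmetric])
      also have "(- u) ^ i = (- 1) ^ i * u ^ i"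
        by (rule power_minus)
      finally have "(- u) ^ k * (- 1) ^ i = u ^ i * (- u) ^ (k - i)"
        by (simp add: mult_ac)
      then have "(- u) ^ k / fact k * (real (k choose i) * (- 1) ^ i * walk q i n)
          = (u ^ i * (- u) ^ (k - i)) * (real (k choose i) / fact k) * walk q i n"
        by (simp add: mult_ac)
      also have "real (k choose i) / fact k = 1 / (fact i * fact (k - i))"
        using i by (simp add: binomial_fact)
      finally show "(- u) ^ k / fact k * (real (k choose i) * (- 1) ^ i * walk q i n) = a i * b (k - i)"
        by (simp add: a_def b_def mult_ac)
    qed simp
    finally show ?thesis .
  qed
  then have "heat_kernel q E x0 u x = (\<Sum>k. \<Sum>i\<le>k. a i * b (k - i))"
    by (simp add: heat_kernel_def heat_semigroup_def)
  also have "\<dots> = suminf a * suminf b"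
    using Cauchy_product_sums[OF a b] by (simp add: sums_iff)
  finally have "heat_kernel q E x0 u x = exp (- u) * suminf a"
    using bs by (simp add: sums_iff)
  moreover have "(\<lambda>m. exp (- u) * a m) sums (exp (- u) * suminf a)"
    by (intro sums_mult summable_sums summable_norm_cancel[OF a])
  ultimately show ?thesis
    unfolding a_def n_def by (simp add: mult.assoc)
qed

section \<open>Spherical function and Green function\<close>

definition phi :: "nat \<Rightarrow> nat \<Rightarrow> real" where
  "phi q n = (1 + (real q - 1) / (real q + 1) * real n) * (1 / sqrt (real q)) ^ n"

lemma phi_le: "phi q n \<le> real (Suc n) * (1 / sqrt (real q)) ^ n"
proof -
  have "(real q - 1) / (real q + 1) * real n \<le> 1 * real n"
    by (intro mult_right_mono) auto
  then show ?thesis unfolding phi_def by (intro mult_right_mono) auto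
qed

lemma phi_ge:
  assumes "q \<ge> 2" shows "real (Suc n) * (1 / sqrt (real q)) ^ n \<le> 3 * phi q n"
proof -
  define x where "x = (real q - 1) / (real q + 1) * real n"
  \<comment> \<open>This is where q >= 2 enters: (q-1)/(q+1) is then at least 1/3.\<close>
  have "1 / 3 * real n \<le> x"
    unfolding x_def using assms by (intro mult_right_mono) (auto simp: le_divide_eq)
  then have "real (Suc n) \<le> 3 * (1 + x)" by simp
  then have "real (Suc n) * (1 / sqrt (real q)) ^ n \<le> 3 * (1 + x) * (1 / sqrt (real q)) ^ n"
    by (intro mult_right_mono) auto
  then show ?thesis unfolding phi_def x_def[symmetric] by (simp only: mult.assoc)
qed

lemma phi_pos: assumes "q \<ge> 2" shows "phi q n > 0"
  using assms by (simp add: phi_def add_pos_nonneg)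

text \<open>A positive eigenfunction at the top of the l2 spectrum: whatever it dominates decays
  like gamma^N under A^N.\<close>

lemma avg_phi:
  assumes "q \<ge> 2" shows "avg q (phi q) n = tree_gamma q * phi q n"
proof -
  define s where "s = sqrt (real q)"
  have s: "s > 0" "real q = s ^ 2" using assms by (simp_all add: s_def)
  have s1: "s^2 + 1 > 0" by (simp add: add_nonneg_pos)
  show ?thesis
  proof (cases n)
    case 0
    have "1 + (s^2 - 1) / (s^2 + 1) = 2 * s^2 / (s^2+1)"
      using s1 by (simp add: field_simps)
    then show ?thesis
      using s by (simp add: 0 phi_def tree_gamma_def s_def[symmetric] power2_eq_square)
  next
    case (Suc m)
    define c where "c = (s^2 - 1) / (s^2 + 1)"
    define p where "p = (1 / s) ^ m"
    have p: "(1 / s) ^ Suc m = p / s" "(1 / s) ^ Suc (Suc m) = p / s^2"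
      by (simp_all add: p_def power2_eq_square)
    have "avg q (phi q) n = ((1 + c * m) * p + s^2 * ((1 + c * (m + 2)) * (p / s^2))) / (s^2 + 1)"
      unfolding Suc avg_Suc phi_def s_def[symmetric] p p_def[symmetric] unfolding s(2) c_def[symmetric] by (simp add: add_ac)
    also have "\<dots> = 2 * (1 + c * (m + 1)) * p / (s^2 + 1)"
      using s by (simp add: algebra_simps)
    also have "\<dots> = (2 * s / (s^2 + 1)) * ((1 + c * (m + 1)) * (p / s))"
      using s(1) by simp
    also have "\<dots> = tree_gamma q * phi q n"
      unfolding Suc phi_def tree_gamma_def s_def[symmetric] p unfolding s(2) c_def[symmetric] by (simp add: add_ac)
    finally show ?thesis .
  qed
qed

lemma tree_gamma_bounds:
  assumes "q \<ge> 2" shows "0 < tree_gamma q" "tree_gamma q < 1"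
proof -
  define s where "s = sqrt (real q)"
  have s: "s > 1" "real q = s ^ 2" using assms by (simp_all add: s_def)
  have "(s - 1)^2 > 0" using s by simp
  then have "2 * s < s^2 + 1" by (simp add: power2_eq_square algebra_simps)
  then show "0 < tree_gamma q" "tree_gamma q < 1"
    using s by (simp_all add: tree_gamma_def s_def[symmetric] add_pos_pos)
qed

text \<open>The radial solution of g - A g = delta that vanishes at infinity, that is, the sum of
  \<open>walk q m n\<close> over all m.\<close>

definition green :: "nat \<Rightarrow> nat \<Rightarrow> real" where
  "green q n = real q / (real q - 1) * (1 / real q) ^ n"

lemma avg_green:
  assumes "q \<ge> 2" shows "green q n - avg q (green q) n = (if n = 0 then 1 else 0)"
proof -
  define Q where "Q = real q"
  have Q: "Q > 1" using assms by (simp add: Q_def)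
  show ?thesis
  proof (cases n)
    case 0
    then show ?thesis using Q by (simp add: green_def Q_def[symmetric] divide_simps)
  next
    case (Suc m)
    define p where "p = (1 / Q) ^ m"
    have p: "(1 / Q) ^ Suc m = p / Q" "(1 / Q) ^ Suc (Suc m) = p / (Q * Q)"
      by (simp_all add: p_def)
    have "(Q / (Q - 1) * p + Q * (Q / (Q - 1) * (p / (Q * Q)))) / (Q + 1) = Q / (Q - 1) * (p / Q)"
      using Q by (simp add: divide_simps) (simp add: algebra_simps)
    then show ?thesis
      unfolding Suc avg_Suc green_def Q_def[symmetric] p p_def[symmetric] by simp
  qed
qed

text \<open>Apply A^m to \<open>avg_green\<close> and telescope. The remainder is kept exactly, so
  that it can be estimated through \<open>phi\<close>.\<close>

lemma sum_walk:
  assumes "q \<ge> 2"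
  shows "(\<Sum>m<N. walk q m n) = green q n - (avg q ^^ N) (green q) n"
proof (induction N arbitrary: n)
  case (Suc N)
  have *: "walk q m n = (avg q ^^ m) (green q) n - (avg q ^^ Suc m) (green q) n" for m n
  proof (induction m arbitrary: n)
    case 0
    then show ?case using avg_green[OF assms, of n] by (simp add: walk_0)
  next
    case (Suc m)
    have "walk q m = (\<lambda>n. (avg q ^^ m) (green q) n - (avg q ^^ Suc m) (green q) n)"
      using Suc by blast
    then show ?case by (simp add: walk_Suc avg_diff)
  qed
  show ?case using Suc[of n] *[of N n] by simp
qed simp

text \<open>Domination by an eigenfunction is what makes the remainder in \<open>sum_walk\<close>
  decay geometrically.\<close>

lemma green_le_phi:
  assumes "q \<ge> 2" shows "green q n \<le> real q / (real q - 1) * phi q n"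
proof -
  have "(1 / real q) ^ n \<le> (1 / sqrt (real q)) ^ n"
  proof (intro power_mono divide_left_mono)
    show "sqrt (real q) \<le> real q"
      using assms by (intro real_le_lsqrt) (auto simp: power2_eq_square)
  qed (use assms in auto)
  also have "\<dots> \<le> phi q n"
  proof -
    have "1 * (1 / sqrt (real q)) ^ n \<le> (1 + (real q - 1) / (real q + 1) * real n) * (1 / sqrt (real q)) ^ n"
      using assms by (intro mult_right_mono) auto
    then show ?thesis by (simp add: phi_def)
  qed
  finally show ?thesis
    unfolding green_def by (rule mult_left_mono) (use assms in auto)
qed

lemma sum_walk_le:
  assumes "q \<ge> 2" shows "(\<Sum>m<N. walk q m n) \<le> 2 * (1 / real q) ^ n"
proof -
  \<comment> \<open>The zero function is written as a multiple of \<open>green\<close> so that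
    \<open>avg_pow_cmult\<close> evaluates its image.\<close>
  have "(avg q ^^ N) (\<lambda>n. 0 * green q n) n \<le> (avg q ^^ N) (green q) n"
    using assms by (intro avg_pow_mono) (simp add: green_def)
  then have "0 \<le> (avg q ^^ N) (green q) n" unfolding avg_pow_cmult by simp
  moreover have "green q n \<le> 2 * (1 / real q) ^ n"
  proof -
    have "real q / (real q - 1) \<le> 2" using assms by (simp add: divide_le_eq)
    then show ?thesis unfolding green_def by (intro mult_right_mono) auto
  qed
  ultimately show ?thesis using sum_walk[OF assms, of n N] by linarith
qed

text \<open>Decay in n uniformly in m. It gives p_t(n) -> 0, which the telescoping near the root
  requires.\<close>

lemma walk_le: assumes "q \<ge> 2" shows "walk q m n \<le> 2 * (1 / real q) ^ n"
proof -
  have "walk q m n \<le> (\<Sum>i<Suc m. walk q i n)"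
    by (rule member_le_sum) (auto simp: walk_nonneg)
  then show ?thesis using sum_walk_le[OF assms, where N="Suc m" and n=n] by linarith
qed

text \<open>The part of the Green series beyond time \<open>C n\<close> is of order \<open>\<gamma>\<^bsup>C n\<^esup> \<phi>(n)\<close>, which is negligible
  against \<open>q\<^bsup>-n\<^esup>\<close> for large \<open>C\<close>.\<close>

lemma sum_walk_ge:
  assumes "q \<ge> 2"
  obtains C :: nat where "C \<ge> 1"
    "\<And>n. n \<ge> 1 \<Longrightarrow> (1 / 2) * (1 / real q) ^ n \<le> (\<Sum>m\<in>{n..<C * n}. walk q m n)"
proof -
  let ?g = "tree_gamma q" and ?\<kappa> = "real q / (real q - 1)"
  note g = tree_gamma_bounds[OF assms]
  \<comment> \<open>The factor 1/q matches the Green function. Of the remaining 1/4 per unit of n,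
    one half absorbs the growth n + 1 <= 2^n of \<open>phi\<close> and the other makes the tail at
    most half of q^(-n).\<close>
  obtain C0 where C0: "?g ^ C0 < 1 / (4 * real q)"
    using real_arch_pow_inv[of "1 / (4 * real q)" ?g] g assms by auto
  define C where "C = Suc C0"
  have C: "?g ^ C \<le> 1 / (4 * real q)"
  proof -
    have "?g ^ C \<le> ?g ^ C0" unfolding C_def using g by (intro power_decreasing) auto
    then show ?thesis using C0 by linarith
  qed
  have "(1 / 2) * (1 / real q) ^ n \<le> (\<Sum>m\<in>{n..<C * n}. walk q m n)" if n: "n \<ge> 1" for n
  proof -
    have phi: "phi q n \<le> 2 ^ n * (1 / sqrt (real q)) ^ n"
    proof -
      have "real (Suc n) \<le> real (2 ^ n)"
        by (intro of_nat_mono Suc_leI less_exp)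
      then have "real (Suc n) * (1 / sqrt (real q)) ^ n \<le> 2 ^ n * (1 / sqrt (real q)) ^ n"
        by (intro mult_right_mono) auto
      with phi_le show ?thesis by (rule order_trans)
    qed
    have "?g ^ (C * n) * phi q n \<le> (1 / (4 * real q)) ^ n * (2 ^ n * 1 ^ n)"
    proof (rule mult_mono)
      show "?g ^ (C * n) \<le> (1 / (4 * real q)) ^ n"
        unfolding power_mult using C g by (intro power_mono) auto
      have "(1 / sqrt (real q)) ^ n \<le> 1 ^ n"
        using assms by (intro power_mono) auto
      then show "phi q n \<le> 2 ^ n * 1 ^ n" using phi by (simp add: mult_left_mono order_trans)
    qed (use assms in \<open>auto simp: phi_def\<close>)
    also have "\<dots> = (1 / 2) ^ n * (1 / real q) ^ n"
      by (simp add: power_mult_distrib[symmetric] del: power_one)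
    also have "\<dots> \<le> (1 / 2) * (1 / real q) ^ n"
      using n power_decreasing[of 1 n "1 / 2 :: real"] by (intro mult_right_mono) auto
    finally have small: "?g ^ (C * n) * phi q n \<le> (1 / 2) * (1 / real q) ^ n" .
    have "(avg q ^^ (C * n)) (green q) n \<le> (avg q ^^ (C * n)) (\<lambda>n. ?\<kappa> * phi q n) n"
      by (intro avg_pow_mono green_le_phi assms)
    also have "\<dots> = ?\<kappa> * (?g ^ (C * n) * phi q n)"
      by (simp only: avg_pow_cmult avg_pow_eigen[OF avg_phi[OF assms]])
    also have "\<dots> \<le> ?\<kappa> * ((1 / 2) * (1 / real q) ^ n)"
      using small assms by (intro mult_left_mono) auto
    also have "\<dots> = (1 / 2) * green q n"
      by (simp add: green_def)
    finally have "(1 / 2) * green q n \<le> (\<Sum>m<C * n. walk q m n)"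
      unfolding sum_walk[OF assms] by simp
    moreover have "1 * (1 / real q) ^ n \<le> green q n"
      unfolding green_def by (rule mult_right_mono) (use assms in auto)
    moreover have "(\<Sum>m<C * n. walk q m n) = (\<Sum>m\<in>{n..<C * n}. walk q m n)"
      by (intro sum.mono_neutral_right) (auto simp: walk_eq_0)
    ultimately show ?thesis by simp
  qed
  then show thesis by (intro that[of C]) (simp_all add: C_def)
qed

section \<open>Power series and elementary inequalities for powers\<close>

text \<open>Differentiation moves coefficient n + 1 to position n up to a nonzero factor, so the
  induction has to range over all series that vanish on (-1, 1).\<close>

lemma powser_zero_imp_coeff_zero:
  fixes d :: "nat \<Rightarrow> real"
  assumes "\<And>x. \<bar>x\<bar> < 1 \<Longrightarrow> (\<lambda>n. d n * x ^ n) sums 0"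
  shows "d n = 0"
  using assms
proof (induction n arbitrary: d)
  case 0
  from 0[of 0] show ?case by simp
next
  case (Suc n)
  have "(\<lambda>n. diffs d n * x ^ n) sums 0" if x: "\<bar>x\<bar> < 1" for x
  proof -
    have sm: "summable (\<lambda>n. d n * y ^ n)" if "norm y < 1" for y
      using Suc.prems[of y] that by (simp add: sums_iff)
    have "((\<lambda>z. \<Sum>n. d n * z ^ n) has_field_derivative (\<Sum>n. diffs d n * x ^ n)) (at x)"
      by (rule termdiffs_strong'[of 1]) (use sm x in auto)
    moreover have "((\<lambda>z. \<Sum>n. d n * z ^ n) has_field_derivative 0) (at x)"
    proof (rule has_field_derivative_transform_within_open[where S="{-1<..<1}"])
      show "((\<lambda>z. 0 :: real) has_field_derivative 0) (at x)" by simp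
    qed (use x Suc.prems in \<open>auto simp: sums_iff abs_less_iff\<close>)
    ultimately have "(\<Sum>n. diffs d n * x ^ n) = 0"
      by (rule DERIV_unique)
    moreover have "summable (\<lambda>n. diffs d n * x ^ n)"
      using x sm by (intro termdiff_converges[of x 1]) auto
    ultimately show ?thesis by (simp add: sums_iff)
  qed
  then have "diffs d n = 0" by (rule Suc.IH)
  then show ?case by (simp add: diffs_def)
qed

text \<open>Bernoulli's inequality for exponents in [0, 1], from convexity of \<open>exp\<close>
  between 0 and \<open>ln z\<close>. Every one-step comparison of powers below rests on it.\<close>

lemma powr_le_linear:
  fixes z b :: real
  assumes "0 \<le> z" "0 \<le> b" "b \<le> 1"
  shows "z powr b \<le> 1 + b * (z - 1)"
proof (cases "z = 0")
  case False
  then have z: "z > 0" using assms by simp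
  have "exp ((1 - b) *\<^sub>R 0 + b *\<^sub>R ln z) \<le> (1 - b) * exp 0 + b * exp (ln z)"
    using convex_onD[OF exp_convex, of b 0 "ln z"] assms by simp
  then show ?thesis using z by (simp add: powr_def algebra_simps)
qed (use assms in simp)

lemma powr_mult_exp_bound:
  fixes p :: real
  assumes "p > 0"
  obtains S where "\<And>x. x > 0 \<Longrightarrow> x powr p * exp (- x / 2) \<le> S"
proof
  fix x :: real assume x: "x > 0"
  \<comment> \<open>The tangent of \<open>ln\<close> is taken at \<open>2 * p\<close>, where x^p
    exp(-x/2) is largest.\<close>
  have "ln (x / (2 * p)) \<le> x / (2 * p) - 1"
    using x assms by (intro ln_le_minus_one) auto
  then have "p * ln (x / (2 * p)) \<le> p * (x / (2 * p) - 1)"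
    using assms by (intro mult_left_mono) auto
  then have "p * ln x \<le> x / 2 + p * ln (2 * p)"
    using x assms by (simp add: ln_div algebra_simps)
  then have "exp (p * ln x - x / 2) \<le> exp (p * ln (2 * p))" by simp
  then show "x powr p * exp (- x / 2) \<le> exp (p * ln (2 * p))"
    using x by (simp add: powr_def mult_exp_exp)
qed

section \<open>The discrete stable law\<close>

text \<open>Taylor coefficients of a (1 - z)^(a-1). Up to the factor t this is the logarithmic
  derivative of exp(-t (1 - z)^a).\<close>

definition stable_coeff :: "real \<Rightarrow> nat \<Rightarrow> real" where
  "stable_coeff a k = a * pochhammer (1 - a) k / fact k"

lemma stable_coeff_0 [simp]: "stable_coeff a 0 = a"
  by (simp add: stable_coeff_def)

lemma stable_coeff_Suc: "stable_coeff a (Suc k) = stable_coeff a k * (1 - a / real (Suc k))"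
  by (simp add: stable_coeff_def pochhammer_Suc field_simps del: of_nat_Suc) (simp add: algebra_simps)

lemma stable_coeff_sums:
  assumes "\<bar>x\<bar> < 1"
  shows "(\<lambda>k. stable_coeff a k * x ^ k) sums (a * (1 - x) powr (a - 1))"
proof -
  have "(\<lambda>k. a * ((a - 1 gchoose k) * (- x) ^ k)) sums (a * (1 + - x) powr (a - 1))"
    using assms by (intro sums_mult gen_binomial_real) auto
  moreover have "a * ((a - 1 gchoose k) * (- x) ^ k) = stable_coeff a k * x ^ k" for k
    by (simp add: gbinomial_pochhammer stable_coeff_def power_minus[of x] mult_ac)
  ultimately show ?thesis by simp
qed

context
  fixes a :: real
  assumes a: "0 < a" "a < 1"
begin

lemma stable_coeff_pos: "0 < stable_coeff a k"
proof (induction k)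
  case (Suc k)
  have "a / real (Suc k) < 1" using a by (simp add: divide_less_eq)
  then show ?case using Suc by (simp add: stable_coeff_Suc del: of_nat_Suc)
qed (use a in simp)

lemma stable_coeff_decseq: "decseq (stable_coeff a)"
proof (rule decseq_SucI)
  fix k
  have "stable_coeff a k * (1 - a / real (Suc k)) \<le> stable_coeff a k * 1"
    using stable_coeff_pos[of k] a by (intro mult_left_mono) auto
  then show "stable_coeff a (Suc k) \<le> stable_coeff a k" by (simp add: stable_coeff_Suc)
qed

text \<open>Compare consecutive ratios: with x = 1/(k+1), Bernoulli gives (1 + x)^a (1 - a x) <= (1
  + a x)(1 - a x) <= 1.\<close>

lemma stable_coeff_le: "stable_coeff a k \<le> a * real (Suc k) powr (- a)"
proof (induction k)
  case (Suc k)
  define x where "x = 1 / real (Suc k)"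
  have x: "0 < x" "x \<le> 1" by (simp_all add: x_def)
  have "a * x \<le> 1" using x a mult_le_one[of a x] by simp
  have S: "real (Suc (Suc k)) = real (Suc k) * (1 + x)" by (simp add: x_def field_simps)
  have "(1 + x) powr a * (1 - a * x) \<le> (1 + a * x) * (1 - a * x)"
    using powr_le_linear[of "1 + x" a] x a \<open>a * x \<le> 1\<close> by (intro mult_right_mono) auto
  also have "\<dots> \<le> 1" using a x by (simp add: algebra_simps)
  finally have "1 - a * x \<le> (1 + x) powr (- a)"
    using x by (simp add: powr_minus field_simps)
  moreover have "stable_coeff a (Suc k) = stable_coeff a k * (1 - a * x)"
    by (simp add: stable_coeff_Suc x_def)
  ultimately have "stable_coeff a (Suc k) \<le> (a * real (Suc k) powr (- a)) * (1 + x) powr (- a)"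
    using Suc a \<open>a * x \<le> 1\<close> by (auto intro!: mult_mono)
  then show ?case unfolding S using x by (simp add: powr_mult)
qed simp

lemma stable_coeff_ge: "a * (1 - a) * real (Suc k) powr (- a) \<le> stable_coeff a k"
proof -
  \<comment> \<open>Bernoulli is now applied at 1 - x, which compares the power with the coefficient
    one index later. The starting value \<open>stable_coeff a 1\<close>, equal to
    \<open>a * (1 - a)\<close>, fixes the constant.\<close>
  have *: "a * (1 - a) * real (Suc k) powr (- a) \<le> stable_coeff a (Suc k)" for k
  proof (induction k)
    case 0
    then show ?case using stable_coeff_Suc[of a 0] by simp
  next
    case (Suc k)
    define x where "x = 1 / real (Suc (Suc k))"
    have x: "0 < x" "x < 1" by (simp_all add: x_def)
    have S: "real (Suc k) = real (Suc (Suc k)) * (1 - x)" by (simp add: x_def field_simps)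
    have "(1 - x) powr a \<le> 1 - a * x"
      using powr_le_linear[of "1 - x" a] x a by simp
    then have "(a * (1 - a) * real (Suc k) powr (- a)) * (1 - x) powr a \<le> stable_coeff a (Suc k) * (1 - a * x)"
      using Suc stable_coeff_pos[of "Suc k"] by (intro mult_mono) auto
    also have "\<dots> = stable_coeff a (Suc (Suc k))"
      by (simp add: stable_coeff_Suc[of a "Suc k"] x_def)
    also have "(a * (1 - a) * real (Suc k) powr (- a)) * (1 - x) powr a = a * (1 - a) * real (Suc (Suc k)) powr (- a)"
      unfolding S using x by (simp add: powr_mult powr_minus)
    finally show ?case .
  qed
  show ?thesis
  proof (cases k)
    case 0
    have "a * (1 - a) \<le> a * 1" using a by (intro mult_left_mono) auto
    then show ?thesis by (simp add: 0)
  next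
    case (Suc j)
    have "real (Suc k) powr (- a) \<le> real (Suc j) powr (- a)"
      using a Suc by (intro powr_mono2') auto
    then have "a * (1 - a) * real (Suc k) powr (- a) \<le> a * (1 - a) * real (Suc j) powr (- a)"
      using a by (intro mult_left_mono) auto
    then show ?thesis using *[of j] Suc by simp
  qed
qed

text \<open>Discrete comparison with an integral: by Bernoulli each increment of L^(1-a) dominates
  (1 - a) (L+1)^(-a), and the increments telescope.\<close>

lemma sum_stable_coeff_le: "(\<Sum>k<L. stable_coeff a k) \<le> a / (1 - a) * real L powr (1 - a)"
proof (induction L)
  case (Suc L)
  define x where "x = 1 / real (Suc L)"
  have x: "0 < x" "x \<le> 1" by (simp_all add: x_def)
  have S: "real L = real (Suc L) * (1 - x)" by (simp add: x_def field_simps)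
  have "(1 - x) powr (1 - a) \<le> 1 - (1 - a) * x"
    using powr_le_linear[of "1 - x" "1 - a"] x a by simp
  then have "real (Suc L) powr (1 - a) * (1 - x) powr (1 - a) \<le> real (Suc L) powr (1 - a) * (1 - (1 - a) * x)"
    by (intro mult_left_mono) auto
  also have "real (Suc L) powr (1 - a) * (1 - x) powr (1 - a) = real L powr (1 - a)"
    unfolding S using x by (simp add: powr_mult)
  also have "real (Suc L) powr (1 - a) * (1 - (1 - a) * x)
      = real (Suc L) powr (1 - a) - (1 - a) * real (Suc L) powr (- a)"
  proof -
    have "real (Suc L) powr (1 - a) * x = real (Suc L) powr (- a)"
      by (simp add: x_def powr_diff powr_minus divide_simps del: of_nat_Suc)
    then show ?thesis by (simp add: algebra_simps)
  qed
  finally have "(1 - a) * real (Suc L) powr (- a) \<le> real (Suc L) powr (1 - a) - real L powr (1 - a)"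
    by simp
  then have "a / (1 - a) * ((1 - a) * real (Suc L) powr (- a))
      \<le> a / (1 - a) * (real (Suc L) powr (1 - a) - real L powr (1 - a))"
    using a by (intro mult_left_mono) auto
  then have "a * real (Suc L) powr (- a) \<le> a / (1 - a) * (real (Suc L) powr (1 - a) - real L powr (1 - a))"
    using a by simp
  then show ?case using Suc stable_coeff_le[of L] by (simp add: algebra_simps)
qed simp

end

text \<open>Such a B is the law of a unit rate Poisson process observed at the stable random time.
  The point z = 1 records total mass 1; negative z are included because z = gamma cos s is inserted
  later.\<close>

definition discrete_stable :: "real \<Rightarrow> real \<Rightarrow> (nat \<Rightarrow> real) \<Rightarrow> bool" where
  "discrete_stable a t B \<longleftrightarrow>
     (\<forall>z. \<bar>z\<bar> \<le> 1 \<longrightarrow> (\<lambda>m. B m * z ^ m) sums exp (- t * (1 - z) powr a))"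

lemma discrete_stable_sums:
  "discrete_stable a t B \<Longrightarrow> \<bar>z\<bar> \<le> 1 \<Longrightarrow> (\<lambda>m. B m * z ^ m) sums exp (- t * (1 - z) powr a)"
  by (simp add: discrete_stable_def)

lemma discrete_stable_0: "discrete_stable a t B \<Longrightarrow> B 0 = exp (- t)"
  using discrete_stable_sums[of a t B 0] by simp

context
  fixes a t :: real and B :: "nat \<Rightarrow> real"
  assumes a: "0 < a" "a < 1" and t: "0 < t" and B: "discrete_stable a t B"
begin

text \<open>Differentiating the generating function \<open>F\<close> gives \<open>F' = t a (1 - z) powr (a - 1) F\<close>.\<close>

lemma discrete_stable_Suc:
  "real (Suc m) * B (Suc m) = t * (\<Sum>k\<le>m. stable_coeff a k * B (m - k))"
proof -
  define G where "G = (\<lambda>m. \<Sum>k\<le>m. stable_coeff a k * B (m - k))"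
  have "(\<lambda>m. (diffs B m - t * G m) * x ^ m) sums 0" if x: "\<bar>x\<bar> < 1" for x
  proof -
    define F where "F = exp (- t * (1 - x) powr a)"
    have sm: "summable (\<lambda>n. B n * y ^ n)" if "norm y < 1" for y
      using discrete_stable_sums[OF B, of y] that by (simp add: sums_iff)
    have "((\<lambda>z. \<Sum>n. B n * z ^ n) has_field_derivative (\<Sum>n. diffs B n * x ^ n)) (at x)"
      by (rule termdiffs_strong'[of 1]) (use sm x in auto)
    moreover have "((\<lambda>z. \<Sum>n. B n * z ^ n) has_field_derivative (t * (a * (1 - x) powr (a - 1) * F))) (at x)"
    proof (rule has_field_derivative_transform_within_open[where S="{-1<..<1}"])
      show "((\<lambda>z. exp (- t * (1 - z) powr a)) has_field_derivative (t * (a * (1 - x) powr (a - 1) * F))) (at x)"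
        using x unfolding F_def by (auto intro!: derivative_eq_intros simp: abs_less_iff)
      show "exp (- t * (1 - z) powr a) = (\<Sum>n. B n * z ^ n)" if "z \<in> {-1<..<1}" for z
      proof -
        have "\<bar>z\<bar> \<le> 1" using that by (auto simp: abs_le_iff)
        then show ?thesis using discrete_stable_sums[OF B, of z] by (simp add: sums_iff)
      qed
    qed (use x in \<open>auto simp: abs_less_iff\<close>)
    ultimately have "(\<Sum>n. diffs B n * x ^ n) = t * (a * (1 - x) powr (a - 1) * F)"
      by (rule DERIV_unique)
    moreover have "summable (\<lambda>n. diffs B n * x ^ n)"
      using x sm by (intro termdiff_converges[of x 1]) auto
    ultimately have 1: "(\<lambda>n. diffs B n * x ^ n) sums (t * (a * (1 - x) powr (a - 1) * F))"
      by (simp add: sums_iff)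
    \<comment> \<open>Convergence at a larger radius K makes both series absolutely convergent at x,
      as the Cauchy product requires.\<close>
    obtain K where K: "\<bar>x\<bar> < K" "K < 1" using x dense by blast
    have c: "summable (\<lambda>k. norm (stable_coeff a k * x ^ k))"
    proof (rule powser_insidea)
      show "summable (\<lambda>n. stable_coeff a n * K ^ n)"
        using stable_coeff_sums[of K a] K by (simp add: sums_iff)
    qed (use K in simp)
    have b: "summable (\<lambda>k. norm (B k * x ^ k))"
      using sm[of K] K by (intro powser_insidea[of B K]) auto
    have "(\<lambda>m. \<Sum>k\<le>m. (stable_coeff a k * x ^ k) * (B (m - k) * x ^ (m - k))) sums
        ((\<Sum>k. stable_coeff a k * x ^ k) * (\<Sum>k. B k * x ^ k))"
      by (rule Cauchy_product_sums[OF c b])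
    moreover have "(\<Sum>k\<le>m. (stable_coeff a k * x ^ k) * (B (m - k) * x ^ (m - k))) = G m * x ^ m" for m
    proof -
      have "(stable_coeff a k * x ^ k) * (B (m - k) * x ^ (m - k)) = stable_coeff a k * B (m - k) * x ^ m"
        if "k \<le> m" for k
      proof -
        have "x ^ m = x ^ k * x ^ (m - k)" using that by (simp add: power_add[symmetric])
        then show ?thesis by (simp only: mult_ac)
      qed
      then show ?thesis unfolding G_def sum_distrib_right by (intro sum.cong) auto
    qed
    moreover have "(\<Sum>k. B k * x ^ k) = F"
      using discrete_stable_sums[OF B, of x] x by (simp add: sums_iff F_def)
    moreover have "(\<Sum>k. stable_coeff a k * x ^ k) = a * (1 - x) powr (a - 1)"
      using stable_coeff_sums[OF x, of a] by (simp add: sums_iff)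
    ultimately have "(\<lambda>m. G m * x ^ m) sums (a * (1 - x) powr (a - 1) * F)"
      by simp
    then have "(\<lambda>m. t * (G m * x ^ m)) sums (t * (a * (1 - x) powr (a - 1) * F))"
      by (rule sums_mult)
    from sums_diff[OF 1 this] show ?thesis
      by (simp add: algebra_simps)
  qed
  from powser_zero_imp_coeff_zero[OF this, of m] show ?thesis
    by (simp add: diffs_def G_def)
qed

lemma discrete_stable_rec:
  assumes "m \<ge> 1"
  shows "real m * B m = t * (\<Sum>k<m. stable_coeff a k * B (m - 1 - k))"
proof -
  obtain j where "m = Suc j" using assms by (cases m) auto
  then show ?thesis
    using discrete_stable_Suc[of j] by (simp add: lessThan_Suc_atMost)
qed

lemma discrete_stable_nonneg: "0 \<le> B m"
proof (induction m rule: less_induct)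
  case (less m)
  show ?case
  proof (cases "m = 0")
    case False
    have "0 \<le> t * (\<Sum>k<m. stable_coeff a k * B (m - 1 - k))"
    proof (intro mult_nonneg_nonneg sum_nonneg)
      fix k assume "k \<in> {..<m}"
      then show "0 \<le> B (m - 1 - k)" by (intro less) auto
    qed (use t stable_coeff_pos[OF a] in \<open>auto intro: less_imp_le\<close>)
    then have "0 \<le> real m * B m"
      using discrete_stable_rec[of m] False by simp
    then show ?thesis using False by (simp add: zero_le_mult_iff)
  qed (simp add: discrete_stable_0[OF B])
qed

lemma discrete_stable_sum_pow_le:
  assumes "finite I" "0 \<le> z" "z \<le> 1"
  shows "(\<Sum>m\<in>I. B m * z ^ m) \<le> exp (- t * (1 - z) powr a)"
proof -
  have "(\<Sum>m\<in>I. B m * z ^ m) \<le> (\<Sum>m. B m * z ^ m)"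
    using discrete_stable_sums[OF B, of z] assms by (intro sum_le_suminf) (auto simp: sums_iff discrete_stable_nonneg)
  then show ?thesis using discrete_stable_sums[OF B, of z] assms by (simp add: sums_iff)
qed

lemma discrete_stable_sum_le_1: "finite I \<Longrightarrow> (\<Sum>m\<in>I. B m) \<le> 1"
  using discrete_stable_sum_pow_le[of I 1] by simp

text \<open>A Chernoff bound: z = 1 - 1/(2m) keeps z^m >= 1/2, while (1 - z)^a is still at least
  m^(-a)/2.\<close>

lemma discrete_stable_sum_le:
  assumes "m \<ge> 1"
  shows "(\<Sum>j\<le>m. B j) \<le> 2 * exp (- (t * real m powr (- a)) / 2)"
proof -
  define z where "z = 1 - 1 / (2 * real m)"
  have z: "0 \<le> z" "z \<le> 1" using assms by (simp_all add: z_def)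
  have "1 + real m * (- 1 / (2 * real m)) \<le> (1 + (- 1 / (2 * real m))) ^ m"
    using assms by (intro Bernoulli_inequality) (auto simp: field_simps)
  then have zm: "1 / 2 \<le> z ^ m" using assms by (simp add: z_def)
  have "(1 / 2) * (\<Sum>j\<le>m. B j) \<le> (\<Sum>j\<le>m. B j * z ^ j)"
    unfolding sum_distrib_left
  proof (rule sum_mono)
    fix j assume "j \<in> {..m}"
    then have "z ^ m \<le> z ^ j" using z by (intro power_decreasing) auto
    then have "(1 / 2) * B j \<le> z ^ j * B j"
      using zm discrete_stable_nonneg by (intro mult_right_mono) auto
    then show "(1 / 2) * B j \<le> B j * z ^ j" by (simp add: mult.commute)
  qed
  also have "\<dots> \<le> exp (- t * (1 - z) powr a)"
    using z by (intro discrete_stable_sum_pow_le) auto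
  also have "\<dots> \<le> exp (- (t * real m powr (- a)) / 2)"
  proof -
    have "1 / 2 = 2 powr (- 1 :: real)" by (simp add: powr_minus)
    also have "\<dots> \<le> 2 powr (- a)" using a by (intro powr_mono) auto
    finally have "(1 / 2) * real m powr (- a) \<le> 2 powr (- a) * real m powr (- a)"
      by (intro mult_right_mono) auto
    also have "\<dots> = (1 - z) powr a"
      using assms by (simp add: z_def powr_minus powr_mult powr_divide field_simps)
    finally have "t * ((1 / 2) * real m powr (- a)) \<le> t * (1 - z) powr a"
      using t by (intro mult_left_mono) auto
    then show ?thesis by simp
  qed
  finally show ?thesis by simp
qed

text \<open>A crude bound for the start of the induction: in the recursion the coefficients are at
  most 1 and the masses add up to at most 1.\<close>

lemma discrete_stable_le_t:
  assumes "m \<ge> 1" shows "real m * B m \<le> t"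
proof -
  have "(\<Sum>k<m. stable_coeff a k * B (m - 1 - k)) \<le> (\<Sum>k<m. 1 * B (m - 1 - k))"
  proof (rule sum_mono)
    fix k assume "k \<in> {..<m}"
    have "stable_coeff a k \<le> 1"
      using decseqD[OF stable_coeff_decseq[OF a], of 0 k] a by simp
    then show "stable_coeff a k * B (m - 1 - k) \<le> 1 * B (m - 1 - k)"
      by (intro mult_right_mono discrete_stable_nonneg)
  qed
  also have "\<dots> = (\<Sum>j<m. B j)"
    using sum.nat_diff_reindex[of B m] by simp
  also have "\<dots> \<le> 1"
    by (rule discrete_stable_sum_le_1) simp
  finally have "t * (\<Sum>k<m. stable_coeff a k * B (m - 1 - k)) \<le> t * 1"
    using t by (intro mult_left_mono) auto
  then show ?thesis using discrete_stable_rec[OF assms] by simp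
qed

end

text \<open>Evaluating the generating function at \<open>z = 1 - l / m\<close> bounds the mass below \<open>m\<close> from below:
  \<open>t (1 - z)\<^bsup>a\<^esup>\<close> grows only like \<open>l\<^bsup>a\<^esup>\<close>, whereas the terms beyond \<open>m\<close> contribute at most \<open>e\<^bsup>-l\<^esup>\<close>.\<close>

lemma discrete_stable_ge:
  fixes a \<tau> :: real
  assumes a: "0 < a" "a < 1" and \<tau>: "0 < \<tau>"
  obtains c where "c > 0"
    "\<And>t B m. 0 < t \<Longrightarrow> discrete_stable a t B \<Longrightarrow> m \<ge> 1 \<Longrightarrow> t * real m powr (- a) \<le> \<tau> \<Longrightarrow>
      c * t * real m powr (- 1 - a) \<le> B m"
proof -
  \<comment> \<open>Chosen so that \<tau> l^a = l/2: the generating function at 1 - l/m is then at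
    least exp(-l/2), which exceeds the contribution exp(-l) of the tail.\<close>
  define l where "l = (2 * \<tau>) powr (1 / (1 - a))"
  have l: "l > 0" using \<tau> by (simp add: l_def)
  have "\<tau> * l powr a = l / 2"
  proof -
    have "l powr (1 - a) = 2 * \<tau>" using a \<tau> by (simp add: l_def powr_powr)
    then have "l = l powr a * (2 * \<tau>)"
      using l powr_add[of l a "1 - a"] by simp
    then show ?thesis by (simp add: mult_ac)
  qed
  define \<delta> where "\<delta> = min (exp (- (l / 2))) (exp (- (l / 2)) - exp (- l))"
  have \<delta>: "\<delta> > 0" using l by (simp add: \<delta>_def)
  show thesis
  proof (rule that)
    show "a * (1 - a) * \<delta> > 0" using a \<delta> by simp
    fix t :: real and B m
    assume t: "0 < t" and B: "discrete_stable a t B" and m: "m \<ge> 1" and T: "t * real m powr (- a) \<le> \<tau>"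
    note nonneg = discrete_stable_nonneg[OF a t B]
    have mass: "\<delta> \<le> (\<Sum>j<m. B j)"
    \<comment> \<open>For m < l the point 1 - l/m would be negative. In that case t <= l/2, and the
      single mass B 0 = exp(-t) is enough.\<close>
    proof (cases "real m < l")
      case True
      have "t = t * real m powr (- a) * real m powr a"
        using m by (simp add: powr_minus)
      also have "\<dots> \<le> \<tau> * l powr a"
        using True T \<tau> a by (intro mult_mono powr_mono2) auto
      finally have "exp (- (l / 2)) \<le> B 0"
        using \<open>\<tau> * l powr a = l / 2\<close> discrete_stable_0[OF B] by simp
      also have "\<dots> \<le> (\<Sum>j<m. B j)"
        using m nonneg by (intro member_le_sum) auto
      finally show ?thesis unfolding \<delta>_def by (rule min.coboundedI1)
    next
      case False
      define z where "z = 1 - l / real m"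
      have z: "0 \<le> z" "z \<le> 1" using False l m by (simp_all add: z_def)
      have zm: "z ^ m \<le> exp (- l)"
      proof -
        have "z \<le> exp (- (l / real m))"
          using exp_ge_add_one_self[of "- (l / real m)"] by (simp add: z_def)
        then have "z ^ m \<le> exp (- (l / real m)) ^ m"
          using z by (intro power_mono) auto
        also have "\<dots> = exp (- l)"
          using m by (simp add: exp_of_nat_mult[symmetric])
        finally show ?thesis .
      qed
      have s1: "(\<lambda>j. B j * z ^ j) sums exp (- t * (1 - z) powr a)"
        using z by (intro discrete_stable_sums[OF B]) auto
      have s2: "B j * z ^ j \<le> (if j < m then B j else 0) + exp (- l) * B j" for j
      proof (cases "j < m")
        case True
        have "B j * z ^ j \<le> B j * 1"
          using z by (intro mult_left_mono nonneg power_le_one) auto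
        moreover have "0 \<le> exp (- l) * B j" using nonneg by simp
        ultimately show ?thesis using True by simp
      next
        case False
        have "z ^ j \<le> z ^ m" using z False by (intro power_decreasing) auto
        then have "B j * z ^ j \<le> B j * exp (- l)"
          using zm by (intro mult_left_mono nonneg) auto
        then show ?thesis using False by (simp add: mult.commute)
      qed
      have s3: "(\<lambda>j. (if j < m then B j else 0) + exp (- l) * B j) sums ((\<Sum>j<m. B j) + exp (- l) * 1)"
      proof (intro sums_add sums_mult)
        show "(\<lambda>j. if j < m then B j else 0) sums (\<Sum>j<m. B j)"
          using sums_If_finite_set[of "{..<m}" B] by simp
        show "B sums 1" using discrete_stable_sums[OF B, of 1] by simp
      qed
      have "exp (- t * (1 - z) powr a) \<le> (\<Sum>j<m. B j) + exp (- l) * 1"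
        by (rule sums_le[OF s2 s1 s3])
      moreover have "exp (- (l / 2)) \<le> exp (- t * (1 - z) powr a)"
      proof -
        have "t * (1 - z) powr a = (t * real m powr (- a)) * l powr a"
          using l m by (simp add: z_def powr_divide powr_minus field_simps)
        also have "\<dots> \<le> \<tau> * l powr a"
          using T by (intro mult_right_mono) auto
        finally show ?thesis using \<open>\<tau> * l powr a = l / 2\<close> by simp
      qed
      ultimately have "exp (- (l / 2)) - exp (- l) \<le> (\<Sum>j<m. B j)" by linarith
      then show ?thesis unfolding \<delta>_def by (rule min.coboundedI2)
    qed
    \<comment> \<open>All coefficients in the recursion for m are at least the last one, hence at
      least c; so the mass below m passes directly into B m.\<close>
    define c where "c = a * (1 - a) * real m powr (- a)"
    have "t * (c * \<delta>) \<le> t * (c * (\<Sum>j<m. B j))"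
      using mass t a by (intro mult_left_mono) (auto simp: c_def)
    also have "(\<Sum>j<m. B j) = (\<Sum>k<m. B (m - 1 - k))"
      using sum.nat_diff_reindex[of B m] by simp
    also have "t * (c * (\<Sum>k<m. B (m - 1 - k))) \<le> t * (\<Sum>k<m. stable_coeff a k * B (m - 1 - k))"
      unfolding sum_distrib_left[of c]
    proof (intro mult_left_mono sum_mono)
      fix k assume k: "k \<in> {..<m}"
      have "c \<le> stable_coeff a (m - 1)"
        using stable_coeff_ge[OF a, of "m - 1"] m by (simp add: c_def)
      also have "\<dots> \<le> stable_coeff a k"
        using k by (intro decseqD[OF stable_coeff_decseq[OF a]]) auto
      finally show "c * B (m - 1 - k) \<le> stable_coeff a k * B (m - 1 - k)"
        by (intro mult_right_mono nonneg)
    qed (use t in simp)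
    also have "\<dots> = real m * B m"
      using discrete_stable_rec[OF a t B m] by simp
    finally have "t * (c * \<delta>) / real m \<le> B m"
      using m by (simp add: divide_le_eq mult.commute)
    moreover have "real m powr (- 1 - a) = real m powr (- a) / real m"
      using m powr_diff[of "real m" "- a" 1] by (simp add: minus_diff_commute)
    ultimately show "a * (1 - a) * \<delta> * t * real m powr (- 1 - a) \<le> B m"
      by (simp add: c_def mult_ac)
  qed
qed

text \<open>
  With \<open>T = t m\<^bsup>-a\<^esup>\<close> the claim reads \<open>m B(m) \<le> D T\<close>. The recursion is split at \<open>L \<approx> \<theta> m\<close>, where \<open>\<theta>\<close>
  decays like a power of \<open>T\<close> so that the terms \<open>k < L\<close> are absorbed by the induction hypothesis. The
  remaining terms carry the exponential factor \<open>e\<^bsup>-T/2\<^esup>\<close>, which beats every power of \<open>T\<close>.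
\<close>

lemma discrete_stable_le:
  fixes a :: real
  assumes a: "0 < a" "a < 1"
  obtains D where "D > 0"
    "\<And>t B m. 0 < t \<Longrightarrow> discrete_stable a t B \<Longrightarrow> m \<ge> 1 \<Longrightarrow> B m \<le> D * t * real m powr (- 1 - a)"
proof -
  define p where "p = 1 / (1 - a)"
  have p: "p > 0" using a by (simp add: p_def)
  \<comment> \<open>The quotient comes from \<open>sum_stable_coeff_le\<close>. A factor 4 is lost
    when the bound for B (m - 1 - k), k < L <= m/2, is expressed through m, and a last factor 2
    yields the 1/2 in \<open>near\<close>.\<close>
  define C where "C = 8 * (a / (1 - a))"
  have C: "C > 0" using a by (simp add: C_def)
  obtain S0 where S0: "\<And>x. x > 0 \<Longrightarrow> x powr p * exp (- x / 2) \<le> S0"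
    using powr_mult_exp_bound[OF p] by blast
  define S where "S = 2 + C powr p * S0"
  have S: "(2 + (C * T) powr p) * exp (- T / 2) \<le> S" if "T > 0" for T
  proof -
    have "C powr p * (T powr p * exp (- T / 2)) \<le> C powr p * S0"
      using S0[OF that] by (intro mult_left_mono) auto
    moreover have "2 * exp (- T / 2) \<le> 2 * 1" using that by simp
    moreover have "(C * T) powr p = C powr p * T powr p" using C that by (simp add: powr_mult)
    ultimately have "(2 + (C * T) powr p) * exp (- T / 2) = 2 * exp (- T / 2) + C powr p * (T powr p * exp (- T / 2))"
      by (simp add: algebra_simps)
    then show ?thesis
      using \<open>C powr p * (T powr p * exp (- T / 2)) \<le> C powr p * S0\<close> \<open>2 * exp (- T / 2) \<le> 2 * 1\<close>
      unfolding S_def by linarith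
  qed
  have "S > 0" using S[of 1] less_le_trans[of 0 "(2 + (C * 1) powr p) * exp (- 1 / 2)" S]
    by (simp add: add_pos_nonneg)
  \<comment> \<open>The summands serve, in this order, the far part of the recursion, the case L = 0
    with C T >= 1, and m <= 2.\<close>
  define D where "D = 8 * S + 2 * C * S + 4"
  have D: "D > 0" "8 * S \<le> D" "2 * C * S \<le> D" "4 \<le> D"
    using \<open>S > 0\<close> C by (auto simp: D_def add_pos_pos)
  have main: "real m * B m \<le> D * (t * real m powr (- a))"
    if t: "0 < t" and B: "discrete_stable a t B" and "m \<ge> 1" for t B m
    using \<open>m \<ge> 1\<close>
  proof (induction m rule: less_induct)
    case (less m)
    note nonneg = discrete_stable_nonneg[OF a t B]
    have m: "real m \<ge> 1" using less.prems by simp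
    define T where "T = t * real m powr (- a)"
    have T: "T > 0" using t m by (simp add: T_def)
    \<comment> \<open>As p = 1/(1-a), this means W^(1-a) = C T. Cutting near m/(2 + W) thus limits
      the near part to half of D T; the 2 ensures L <= m/2.\<close>
    define W where "W = (C * T) powr p"
    have W: "W > 0" using C T by (simp add: W_def)
    define L where "L = nat \<lfloor>real m / (2 + W)\<rfloor>"
    have L_le: "real L \<le> real m / (2 + W)"
      using W m by (simp add: L_def)
    \<comment> \<open>If L = 0, then m is at most 2 + W and the exponential bound alone suffices
      when C T >= 1. If C T < 1, then W <= 1, so L = 0 with m >= 3 is contradictory.\<close>
    consider "m \<le> 2" | "L = 0" "C * T \<ge> 1" | "L = 0" "C * T < 1" "m \<ge> 3" | "L \<ge> 1"
      by linarith
    then show ?case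
    proof cases
      case 1
      have "real m powr a \<le> real m powr 1" using m a by (intro powr_mono) auto
      then have "1 \<le> 2 * real m powr (- a)"
        using 1 m by (simp add: powr_minus divide_simps)
      then have "t * 1 \<le> t * (2 * real m powr (- a))"
        using t by (intro mult_left_mono) auto
      also have "\<dots> = 2 * (t * real m powr (- a))" by simp
      also have "\<dots> \<le> D * (t * real m powr (- a))"
        using D t by (intro mult_right_mono) auto
      finally show ?thesis using discrete_stable_le_t[OF a t B less.prems] by simp
    next
      case 2
      have "\<lfloor>real m / (2 + W)\<rfloor> \<le> 0" using 2 by (simp add: L_def)
      then have mW: "real m \<le> 2 + W"
        using W by (simp add: floor_le_iff divide_less_eq)
      have "B m \<le> (\<Sum>j\<le>m. B j)" using nonneg by (intro member_le_sum) auto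
      also have "\<dots> \<le> 2 * exp (- T / 2)"
        using discrete_stable_sum_le[OF a t B less.prems] by (simp add: T_def)
      finally have "real m * B m \<le> (2 + W) * (2 * exp (- T / 2))"
        using mW nonneg W by (intro mult_mono) auto
      also have "\<dots> \<le> 2 * S" using S[OF T] by (simp add: W_def algebra_simps)
      also have "\<dots> \<le> 2 * S * (C * T)"
        using 2 \<open>S > 0\<close> by simp
      also have "\<dots> \<le> D * T" using D(3) T by (simp add: mult_ac)
      finally show ?thesis by (simp add: T_def)
    next
      case 3
      have "W \<le> 1 powr p" unfolding W_def using 3 C T p by (intro powr_mono2) auto
      then have "1 \<le> real m / (2 + W)" using 3 W by (simp add: le_divide_eq)
      then have "1 \<le> L" by (simp add: L_def le_nat_iff le_floor_iff)
      then show ?thesis using 3 by simp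
    next
      case 4
      define \<theta> where "\<theta> = real L / real m"
      have \<theta>0: "0 < \<theta>" using 4 m by (simp add: \<theta>_def)
      have \<theta>1: "\<theta> \<le> 1 / (2 + W)" using L_le m W by (simp add: \<theta>_def pos_le_divide_eq pos_divide_le_eq mult_ac)
      have \<theta>2: "1 / \<theta> \<le> 2 * (2 + W)"
      proof -
        have "real m / (2 + W) < real L + 1"
          using m W by (simp add: L_def)
        then have "real m / (2 + W) \<le> 2 * real L" using 4 by simp
        then show ?thesis using 4 W by (simp add: \<theta>_def divide_simps mult_ac)
      qed
      have "\<theta> \<le> 1 / 2"
        using \<theta>1 W order_trans[of \<theta> "1 / (2 + W)" "1 / 2"] by (simp add: frac_le)
      then have L2: "2 * real L \<le> real m" using m by (simp add: \<theta>_def divide_simps)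
      have "L \<le> m" using L2 by linarith
      have near: "C / 2 * \<theta> powr (1 - a) * T \<le> 1 / 2"
      proof -
        have "\<theta> \<le> 1 / W" using \<theta>1 W order_trans[of \<theta> "1 / (2 + W)" "1 / W"] by (simp add: frac_le)
        then have "\<theta> powr (1 - a) \<le> (1 / W) powr (1 - a)"
          using a \<theta>0 by (intro powr_mono2) auto
        also have "\<dots> = 1 / (C * T)"
          using a C T by (simp add: W_def powr_divide powr_powr p_def)
        finally show ?thesis using C T by (simp add: field_simps)
      qed
      have far: "2 * \<theta> powr (- a) * exp (- T / 2) \<le> D / 2"
      proof -
        have "\<theta> powr (- a) \<le> \<theta> powr (- 1)"
          using \<theta>0 \<open>\<theta> \<le> 1 / 2\<close> a by (intro powr_mono') auto
        also have "\<dots> = 1 / \<theta>" using \<theta>0 by (simp add: powr_minus_divide)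
        finally have "\<theta> powr (- a) \<le> 2 * (2 + W)" using \<theta>2 by linarith
        then have "2 * \<theta> powr (- a) * exp (- T / 2) \<le> 2 * (2 * (2 + W)) * exp (- T / 2)"
          by (intro mult_right_mono mult_left_mono) auto
        also have "\<dots> \<le> 4 * S" using S[OF T] by (simp add: W_def algebra_simps)
        finally show ?thesis using D by simp
      qed
      have sum1: "(\<Sum>k<L. stable_coeff a k * B (m - 1 - k)) \<le> C / 2 * real L powr (1 - a) * (D * T / real m)"
      proof -
        have "B (m - 1 - k) \<le> 4 * (D * T / real m)" if "k < L" for k
        proof -
          define j where "j = m - 1 - k"
          have j: "real m \<le> 2 * real j" "j < m" "1 \<le> j"
            using that L2 m unfolding j_def by linarith+
          have jp: "real j > 0" using j by simp
          have "real j powr (- a) \<le> (real m / 2) powr (- a)"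
            using j a m by (intro powr_mono2') auto
          also have "\<dots> = 2 powr a * real m powr (- a)"
            using m by (simp add: powr_divide powr_minus field_simps)
          also have "\<dots> \<le> 2 * real m powr (- a)"
            using powr_mono[of a 1 2] a by (intro mult_right_mono) auto
          finally have "D * (t * real j powr (- a)) \<le> D * (t * (2 * real m powr (- a)))"
            using D t by (intro mult_left_mono) auto
          then have "real j * B j \<le> 2 * D * T"
            using less.IH[OF j(2,3)] by (simp add: T_def mult_ac)
          then have "B j \<le> 2 * D * T / real j"
            using jp by (simp add: le_divide_eq mult.commute)
          also have "\<dots> \<le> 2 * D * T / (real m / 2)"
            using j D T m by (intro divide_left_mono) auto
          finally show ?thesis by (simp add: j_def mult_ac)
        qed
        then have "(\<Sum>k<L. stable_coeff a k * B (m - 1 - k)) \<le> (\<Sum>k<L. stable_coeff a k * (4 * (D * T / real m)))"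
          using stable_coeff_pos[OF a] by (intro sum_mono mult_left_mono) (auto intro: less_imp_le)
        also have "\<dots> = (\<Sum>k<L. stable_coeff a k) * (4 * (D * T / real m))"
          by (simp only: sum_distrib_right)
        also have "\<dots> \<le> (a / (1 - a) * real L powr (1 - a)) * (4 * (D * T / real m))"
          using sum_stable_coeff_le[OF a] D T m by (intro mult_right_mono) auto
        also have "\<dots> = C / 2 * real L powr (1 - a) * (D * T / real m)"
        proof -
          have "8 * x / 2 = 4 * x" for x :: real by simp
          then have "C / 2 = 4 * (a / (1 - a))" unfolding C_def .
          then show ?thesis by (simp only: mult_ac)
        qed
        finally show ?thesis .
      qed
      have sum2: "(\<Sum>k\<in>{L..<m}. stable_coeff a k * B (m - 1 - k)) \<le> real L powr (- a) * (2 * exp (- T / 2))"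
      proof -
        have cL: "stable_coeff a k \<le> real L powr (- a)" if "L \<le> k" for k
        proof -
          have "stable_coeff a k \<le> a * real (Suc k) powr (- a)"
            by (rule stable_coeff_le[OF a])
          also have "\<dots> \<le> 1 * real L powr (- a)"
            using a that 4 by (intro mult_mono powr_mono2') auto
          finally show ?thesis by simp
        qed
        have "(\<Sum>k\<in>{L..<m}. stable_coeff a k * B (m - 1 - k)) \<le> (\<Sum>k\<in>{L..<m}. real L powr (- a) * B (m - 1 - k))"
          by (intro sum_mono mult_right_mono cL nonneg) auto
        also have "\<dots> = real L powr (- a) * (\<Sum>k\<in>{L..<m}. B (m - 1 - k))"
          by (simp only: sum_distrib_left)
        also have "(\<Sum>k\<in>{L..<m}. B (m - 1 - k)) \<le> (\<Sum>k<m. B (m - 1 - k))"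
          by (intro sum_mono2 nonneg) auto
        also have "\<dots> = (\<Sum>j<m. B j)"
          using sum.nat_diff_reindex[of B m] by simp
        also have "\<dots> \<le> (\<Sum>j\<le>m. B j)"
          by (intro sum_mono2 nonneg) auto
        also have "\<dots> \<le> 2 * exp (- T / 2)"
          using discrete_stable_sum_le[OF a t B less.prems] by (simp add: T_def)
        finally show ?thesis by (simp add: mult_left_mono)
      qed
      have "real m * B m = t * ((\<Sum>k<L. stable_coeff a k * B (m - 1 - k))
          + (\<Sum>k\<in>{L..<m}. stable_coeff a k * B (m - 1 - k)))"
      proof -
        have "sum f {..<m} = sum f {..<L} + sum f {L..<m}" for f :: "nat \<Rightarrow> real"
          using \<open>L \<le> m\<close> by (simp add: lessThan_atLeast0 sum.atLeastLessThan_concat)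
        then show ?thesis
          using discrete_stable_rec[OF a t B less.prems] by simp
      qed
      also have "\<dots> \<le> t * (C / 2 * real L powr (1 - a) * (D * T / real m) + real L powr (- a) * (2 * exp (- T / 2)))"
        using sum1 sum2 t by (intro mult_left_mono add_mono) auto
      also have "\<dots> = (C / 2 * \<theta> powr (1 - a) * T) * (D * T) + (2 * \<theta> powr (- a) * exp (- T / 2)) * T"
      proof -
        have e1: "t * (real L powr (1 - a) / real m) = \<theta> powr (1 - a) * T"
        proof -
          have "real m powr (1 - a) = real m * real m powr (- a)"
            using m powr_add[of "real m" 1 "- a"] by simp
          then have "\<theta> powr (1 - a) * (t * real m powr (- a)) = real L powr (1 - a) * t / real m"
            using m 4 by (simp add: \<theta>_def powr_divide)
          then show ?thesis by (simp add: T_def mult_ac)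
        qed
        have e2: "t * real L powr (- a) = \<theta> powr (- a) * T"
          using m 4 by (simp add: \<theta>_def powr_divide T_def)
        have "t * (C / 2 * real L powr (1 - a) * (D * T / real m) + real L powr (- a) * (2 * exp (- T / 2)))
            = C / 2 * (t * (real L powr (1 - a) / real m)) * (D * T) + t * real L powr (- a) * (2 * exp (- T / 2))"
          by (simp add: distrib_left mult_ac)
        then show ?thesis unfolding e1 e2 by (simp add: mult_ac)
      qed
      also have "\<dots> \<le> (1 / 2) * (D * T) + (D / 2) * T"
        using near far D T by (intro add_mono mult_right_mono) auto
      finally show ?thesis by (simp add: T_def)
    qed
  qed
  show thesis
  proof (rule that[OF D(1)])
    fix t :: real and B m assume *: "0 < t" "discrete_stable a t B" "m \<ge> (1::nat)"
    have "B m \<le> D * (t * real m powr (- a)) / real m"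
      using main[OF *] * by (simp add: le_divide_eq mult.commute)
    moreover have "real m powr (- 1 - a) = real m powr (- a) / real m"
      using * powr_diff[of "real m" "- a" 1] by (simp add: minus_diff_commute)
    ultimately show "B m \<le> D * t * real m powr (- 1 - a)"
      by simp
  qed
qed

section \<open>Subordination\<close>

lemma poisson_sums: "(\<lambda>m. exp (- u) * u ^ m / fact m) sums (1 :: real)"
proof -
  have "(\<lambda>m. exp (- u) * (u ^ m /\<^sub>R fact m)) sums (exp (- u) * exp u)"
    by (intro sums_mult exp_converges)
  then show ?thesis by (simp add: exp_minus divide_inverse mult_ac)
qed

text \<open>Mixed Poisson weights: the Poisson probability of m, averaged over a mean with density
  f.\<close>

definition poisson_mix :: "(real \<Rightarrow> real) \<Rightarrow> nat \<Rightarrow> real" where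
  "poisson_mix f m = (LBINT u:{0<..}. exp (- u) * u ^ m / fact m * f u)"

text \<open>Poisson weights add up to 1, so |f| dominates all partial sums and f may have any sign.
  Powers s m = z^m give the generating function, s m = \<open>walk q m n\<close> gives the
  kernel.\<close>

lemma poisson_mix_sums:
  fixes f :: "real \<Rightarrow> real" and s :: "nat \<Rightarrow> real"
  assumes f: "set_integrable lborel {0<..} f" and s: "\<And>m. \<bar>s m\<bar> \<le> 1"
  shows "(\<lambda>m. poisson_mix f m * s m) sums (LBINT u:{0<..}. (\<Sum>m. exp (- u) * u ^ m / fact m * s m) * f u)"
proof -
  define h where "h = (\<lambda>u. indicator {0<..} u *\<^sub>R f u)"
  have h: "integrable lborel h"
    using f by (simp add: set_integrable_def h_def)
  define p where "p = (\<lambda>m (u :: real). exp (- u) * u ^ m / fact m)"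
  have p0: "0 \<le> p m u" if "u > 0" for m u using that by (simp add: p_def)
  have psum: "(\<Sum>m<N. p m u) \<le> 1" if "u > 0" for N u
    using sum_le_suminf[of "\<lambda>m. p m u" "{..<N}"] poisson_sums[of u] p0[OF that] by (simp add: sums_iff p_def)
  have p1: "p m u \<le> 1" if "u > 0" for m u
    using psum[OF that, of "Suc m"] member_le_sum[of m "{..<Suc m}" "\<lambda>m. p m u"] p0[OF that] by auto
  have bound: "norm (p m u * s m * h u) \<le> p m u * norm (h u)" for m u
  proof (cases "u > 0")
    case True
    have "norm (p m u * s m * h u) = p m u * \<bar>s m\<bar> * \<bar>h u\<bar>"
      using p0[OF True] by (simp add: abs_mult)
    also have "\<dots> \<le> p m u * 1 * \<bar>h u\<bar>"
      using p0[OF True] s by (intro mult_right_mono mult_left_mono) auto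
    finally show ?thesis by simp
  qed (simp add: h_def)
  have bound1: "p m u * norm (h u) \<le> norm (h u)" for m u
    by (cases "u > 0") (auto simp: h_def p1 mult_left_le_one_le p0)
  have int: "integrable lborel (\<lambda>u. p m u * s m * h u)" for m
  proof (rule Bochner_Integration.integrable_bound[OF h])
    show "(\<lambda>u. p m u * s m * h u) \<in> borel_measurable lborel"
      using borel_measurable_integrable[OF h] unfolding p_def by measurable
    show "AE u in lborel. norm (p m u * s m * h u) \<le> norm (h u)"
      by (intro AE_I2 order_trans[OF bound bound1])
  qed
  have "(\<lambda>m. \<integral>u. p m u * s m * h u \<partial>lborel) sums (\<integral>u. (\<Sum>m. p m u * s m * h u) \<partial>lborel)"
  proof (rule sums_integral[OF int])
    show "AE u in lborel. summable (\<lambda>m. norm (p m u * s m * h u))"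
    proof (rule AE_I2)
      fix u
      have "summable (\<lambda>m. p m u * norm (h u))"
        using poisson_sums[of u] by (intro summable_mult2) (simp add: p_def sums_iff)
      then show "summable (\<lambda>m. norm (p m u * s m * h u))"
        by (rule summable_comparison_test[rotated]) (use bound[of _ u] in auto)
    qed
    show "summable (\<lambda>m. \<integral>u. norm (p m u * s m * h u) \<partial>lborel)"
    proof (rule summableI_nonneg_bounded)
      fix N
      have "(\<Sum>m<N. \<integral>u. norm (p m u * s m * h u) \<partial>lborel) = (\<integral>u. (\<Sum>m<N. norm (p m u * s m * h u)) \<partial>lborel)"
        by (intro Bochner_Integration.integral_sum[symmetric] integrable_norm int)
      also have "\<dots> \<le> (\<integral>u. norm (h u) \<partial>lborel)"
      proof (rule integral_mono)
        show "integrable lborel (\<lambda>u. \<Sum>m<N. norm (p m u * s m * h u))"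
          by (intro Bochner_Integration.integrable_sum integrable_norm int)
        show "integrable lborel (\<lambda>u. norm (h u))" using h by simp
        fix u
        have "(\<Sum>m<N. norm (p m u * s m * h u)) \<le> (\<Sum>m<N. p m u * norm (h u))"
          by (intro sum_mono bound)
        also have "\<dots> = (\<Sum>m<N. p m u) * norm (h u)" by (simp only: sum_distrib_right)
        also have "\<dots> \<le> norm (h u)"
        proof (cases "u > 0")
          case True
          have "(\<Sum>m<N. p m u) * norm (h u) \<le> 1 * norm (h u)"
            by (intro mult_right_mono psum True) auto
          then show ?thesis by simp
        qed (simp add: h_def)
        finally show "(\<Sum>m<N. norm (p m u * s m * h u)) \<le> norm (h u)" .
      qed
      finally show "(\<Sum>m<N. \<integral>u. norm (p m u * s m * h u) \<partial>lborel) \<le> (\<integral>u. norm (h u) \<partial>lborel)" .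
    qed simp
  qed
  moreover have "(\<integral>u. p m u * s m * h u \<partial>lborel) = poisson_mix f m * s m" for m
  proof -
    have "(\<integral>u. p m u * s m * h u \<partial>lborel) = (\<integral>u. (indicator {0<..} u *\<^sub>R (p m u * f u)) * s m \<partial>lborel)"
      by (intro Bochner_Integration.integral_cong) (auto simp: h_def)
    also have "\<dots> = (\<integral>u. indicator {0<..} u *\<^sub>R (p m u * f u) \<partial>lborel) * s m"
      by (rule integral_mult_left_zero)
    finally show ?thesis by (simp add: poisson_mix_def set_lebesgue_integral_def p_def)
  qed
  moreover have "(\<integral>u. (\<Sum>m. p m u * s m * h u) \<partial>lborel)
      = (LBINT u:{0<..}. (\<Sum>m. exp (- u) * u ^ m / fact m * s m) * f u)"
    unfolding set_lebesgue_integral_def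
  proof (intro Bochner_Integration.integral_cong refl)
    fix u
    have "summable (\<lambda>m. p m u * s m)" if "u > 0"
    proof (rule summable_comparison_test)
      show "summable (\<lambda>m. p m u)" using poisson_sums[of u] by (simp add: p_def sums_iff)
      have "norm (p m u * s m) \<le> p m u" for m
        using p0[OF that, of m] mult_left_mono[OF s[of m], of "p m u"] by (simp add: abs_mult)
      then show "\<exists>N. \<forall>m\<ge>N. norm (p m u * s m) \<le> p m u" by blast
    qed
    then have "(\<Sum>m. p m u * s m * f u) = (\<Sum>m. p m u * s m) * f u" if "u > 0"
      using that by (simp add: suminf_mult2)
    then show "(\<Sum>m. p m u * s m * h u) = indicator {0<..} u *\<^sub>R ((\<Sum>m. exp (- u) * u ^ m / fact m * s m) * f u)"
      by (simp add: h_def p_def indicator_def)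
  qed
  ultimately show ?thesis by simp
qed

lemma stable_density_integrable: "stable_density \<alpha> t f \<Longrightarrow> set_integrable lborel {0<..} f"
  unfolding stable_density_def by (drule spec[of _ 0]) simp

lemma discrete_stable_poisson_mix:
  assumes "stable_density \<alpha> t f"
  shows "discrete_stable (\<alpha> / 2) t (poisson_mix f)"
  unfolding discrete_stable_def
proof (intro allI impI)
  fix z :: real assume z: "\<bar>z\<bar> \<le> 1"
  have "(\<Sum>m. exp (- u) * u ^ m / fact m * z ^ m) = exp (- (1 - z) * u)" for u
  proof -
    have "(\<lambda>m. exp (- u) * ((u * z) ^ m /\<^sub>R fact m)) sums (exp (- u) * exp (u * z))"
      by (intro sums_mult exp_converges)
    then have "(\<lambda>m. exp (- u) * u ^ m / fact m * z ^ m) sums (exp (- u) * exp (u * z))"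
      by (simp add: power_mult_distrib divide_inverse mult_ac)
    then show ?thesis by (simp add: sums_iff mult_exp_exp algebra_simps)
  qed
  then have eq: "(\<Sum>m. exp (- u) * u ^ m / fact m * z ^ m) * f u = exp (- (1 - z) * u) * f u" for u
    by simp
  have "(\<lambda>m. poisson_mix f m * z ^ m) sums (LBINT u:{0<..}. (\<Sum>m. exp (- u) * u ^ m / fact m * z ^ m) * f u)"
    using z by (intro poisson_mix_sums stable_density_integrable[OF assms]) (simp add: power_abs power_le_one)
  moreover have "(LBINT u:{0<..}. exp (- (1 - z) * u) * f u) = exp (- t * (1 - z) powr (\<alpha> / 2))"
  proof -
    have "0 \<le> 1 - z" using z by simp
    then show ?thesis using assms unfolding stable_density_def by blast
  qed
  ultimately show "(\<lambda>m. poisson_mix f m * z ^ m) sums exp (- t * (1 - z) powr (\<alpha> / 2))"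
    unfolding eq by simp
qed

lemma stable_kernel_sums:
  assumes "homogeneous_tree q E" "stable_density \<alpha> t (\<eta> t)"
  shows "(\<lambda>m. poisson_mix (\<eta> t) m * walk q m (graph_dist E x0 x)) sums stable_kernel q E x0 \<eta> t x"
proof -
  have "heat_kernel q E x0 u x = (\<Sum>m. exp (- u) * u ^ m / fact m * walk q m (graph_dist E x0 x))" for u
    using heat_kernel_poisson[OF assms(1), of u x0 x] by (simp add: sums_iff)
  then show ?thesis
    using poisson_mix_sums[OF stable_density_integrable[OF assms(2)], of "\<lambda>m. walk q m (graph_dist E x0 x)"]
    by (simp add: stable_kernel_def walk_nonneg walk_le_1)
qed

section \<open>Estimates far from the root\<close>

lemma stable_walk_far:
  fixes q :: nat and a M :: real
  assumes q: "q \<ge> 2" and a: "0 < a" "a < 1" and M: "M > 0"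
  obtains c D where "c > 0" "D > 0"
    "\<And>t B n p. t > 0 \<Longrightarrow> discrete_stable a t B \<Longrightarrow> real n > M * t powr (1 / a) \<Longrightarrow>
       (\<lambda>m. B m * walk q m n) sums p \<Longrightarrow>
       c * (t * real n powr (- 1 - a) * (1 / real q) ^ n) \<le> p \<and>
       p \<le> D * (t * real n powr (- 1 - a) * (1 / real q) ^ n)"
proof -
  obtain D where D: "D > 0" "\<And>t B m. 0 < t \<Longrightarrow> discrete_stable a t B \<Longrightarrow> m \<ge> 1 \<Longrightarrow> B m \<le> D * t * real m powr (- 1 - a)"
    using discrete_stable_le[OF a] by metis
  \<comment> \<open>If n > M t^(1/a), then t m^(-a) <= M^(-a) for all m >= n, as the lower bound on
    B requires.\<close>
  define \<tau> where "\<tau> = M powr (- a)"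
  have "\<tau> > 0" using M by (simp add: \<tau>_def)
  then obtain c where c: "c > 0" "\<And>t B m. 0 < t \<Longrightarrow> discrete_stable a t B \<Longrightarrow> m \<ge> 1 \<Longrightarrow>
      t * real m powr (- a) \<le> \<tau> \<Longrightarrow> c * t * real m powr (- 1 - a) \<le> B m"
    using discrete_stable_ge[OF a] by metis
  obtain C :: nat where C: "C \<ge> 1"
    "\<And>n. n \<ge> 1 \<Longrightarrow> (1 / 2) * (1 / real q) ^ n \<le> (\<Sum>m\<in>{n..<C * n}. walk q m n)"
    using sum_walk_ge[OF q] by metis
  \<comment> \<open>On the window n <= m < C n the power m^(-1-a) is at least its value at C n; the
    window collects at least half of q^(-n).\<close>
  define c' where "c' = c * real C powr (- 1 - a) / 2"
  show thesis
  proof (rule that)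
    show "c' > 0" using c C by (simp add: c'_def)
    show "2 * D > 0" using D by simp
    fix t B n p
    assume t: "t > (0::real)" and B: "discrete_stable a t B" and far: "real n > M * t powr (1 / a)"
      and p: "(\<lambda>m. B m * walk q m n) sums p"
    note nonneg = discrete_stable_nonneg[OF a t B]
    have n: "n \<ge> 1"
    proof -
      have "M * t powr (1 / a) \<ge> 0" using M by simp
      then show ?thesis using far by linarith
    qed
    have T: "t * real m powr (- a) \<le> \<tau>" if "m \<ge> n" for m
    proof -
      have "t = (t powr (1 / a)) powr a" using a t by (simp add: powr_powr)
      also have "\<dots> \<le> (real m / M) powr a"
        using far that M a by (intro powr_mono2) (auto simp: field_simps)
      also have "\<dots> = \<tau> * real m powr a"
        using M by (simp add: powr_divide \<tau>_def powr_minus_divide)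
      finally have "t * real m powr (- a) \<le> \<tau> * real m powr a * real m powr (- a)"
        by (intro mult_right_mono) auto
      also have "\<dots> = \<tau>" using n that by (simp add: powr_minus)
      finally show ?thesis .
    qed
    have upper: "p \<le> 2 * D * (t * real n powr (- 1 - a) * (1 / real q) ^ n)"
      unfolding sums_unique[OF p]
    proof (rule suminf_le_const[OF sums_summable[OF p]])
      fix N
      have "(\<Sum>m<N. B m * walk q m n) \<le> (\<Sum>m<N. D * t * real n powr (- 1 - a) * walk q m n)"
      proof (rule sum_mono)
        fix m
        show "B m * walk q m n \<le> D * t * real n powr (- 1 - a) * walk q m n"
        proof (cases "m \<ge> n")
          case True
          have "B m \<le> D * t * real m powr (- 1 - a)"
            using True n by (intro D t B) auto
          also have "\<dots> \<le> D * t * real n powr (- 1 - a)"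
            using True n a t D by (intro mult_left_mono powr_mono2') auto
          finally show ?thesis by (intro mult_right_mono walk_nonneg)
        qed (simp add: walk_eq_0)
      qed
      also have "\<dots> = D * t * real n powr (- 1 - a) * (\<Sum>m<N. walk q m n)"
        by (simp only: sum_distrib_left)
      also have "\<dots> \<le> D * t * real n powr (- 1 - a) * (2 * (1 / real q) ^ n)"
        using D t by (intro mult_left_mono sum_walk_le q) auto
      finally show "(\<Sum>m<N. B m * walk q m n) \<le> 2 * D * (t * real n powr (- 1 - a) * (1 / real q) ^ n)"
        by (simp add: mult_ac)
    qed
    have lower: "c' * (t * real n powr (- 1 - a) * (1 / real q) ^ n) \<le> p"
    proof -
      define b where "b = c * t * (real C * real n) powr (- 1 - a)"
      have b: "b = 2 * (c' * (t * real n powr (- 1 - a)))"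
        using C n by (simp add: b_def c'_def powr_mult)
      have "b * ((1 / 2) * (1 / real q) ^ n) \<le> b * (\<Sum>m\<in>{n..<C * n}. walk q m n)"
        using c t by (intro mult_left_mono C n) (auto simp: b_def)
      also have "\<dots> = (\<Sum>m\<in>{n..<C * n}. b * walk q m n)"
        by (simp only: sum_distrib_left)
      also have "\<dots> \<le> (\<Sum>m\<in>{n..<C * n}. B m * walk q m n)"
      proof (intro sum_mono mult_right_mono walk_nonneg)
        fix m assume m: "m \<in> {n..<C * n}"
        have "real m \<le> real C * real n" using m of_nat_mono[of m "C * n"] by simp
        then have "b \<le> c * t * real m powr (- 1 - a)"
          using m n c t a unfolding b_def by (intro mult_left_mono powr_mono2') auto
        also have "\<dots> \<le> B m"
          using m n by (intro c t B T) auto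
        finally show "b \<le> B m" .
      qed
      also have "\<dots> \<le> (\<Sum>m. B m * walk q m n)"
        using p by (intro sum_le_suminf) (auto simp: sums_iff nonneg walk_nonneg)
      also have "\<dots> = p" using p by (simp add: sums_iff)
      finally show ?thesis unfolding b by (simp add: mult_ac)
    qed
    show "c' * (t * real n powr (- 1 - a) * (1 / real q) ^ n) \<le> p \<and>
       p \<le> 2 * D * (t * real n powr (- 1 - a) * (1 / real q) ^ n)"
      using upper lower by blast
  qed
qed

section \<open>Spectral representation\<close>

lemma set_integrable_continuous_Icc:
  fixes f :: "real \<Rightarrow> real"
  assumes "\<And>x. isCont f x" shows "set_integrable lborel {a..b} f"
  using assms by (intro borel_integrable_atLeastAtMost' continuous_at_imp_continuous_on) auto

text \<open>For even f this is the coefficient of f at the n-th Chebyshev polynomial of the second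
  kind in cos s, with respect to the semicircle law on [-1, 1].\<close>

definition sine_coeff :: "(real \<Rightarrow> real) \<Rightarrow> nat \<Rightarrow> real" where
  "sine_coeff f n = (1 / pi) * (LBINT s:{- pi..pi}. f s * (sin s * sin (real (Suc n) * s)))"

lemma sine_coeff_1: "sine_coeff (\<lambda>s. 1) n = (if n = 0 then 1 else 0)"
proof (cases "n = 0")
  case True
  have "(\<integral>s. (1 * (sin s * sin (real (Suc n) * s))) * indicator {- pi..pi} s \<partial>lborel)
      = (pi / 2 - sin (2 * pi) / 4) - (- pi / 2 - sin (2 * - pi) / 4)"
  proof (rule integral_FTC_Icc_real[where F="\<lambda>s. s / 2 - sin (2 * s) / 4"])
    fix s :: real
    have "cos (s * 2) = 1 - 2 * (sin s * sin s)"
      using cos_double_sin[of s] by (simp add: power2_eq_square mult.commute)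
    then show "DERIV (\<lambda>s. s / 2 - sin (2 * s) / 4) s :> 1 * (sin s * sin (real (Suc n) * s))"
      by (auto intro!: derivative_eq_intros simp: True algebra_simps)
  qed (auto intro!: continuous_intros)
  then show ?thesis
    using True by (simp add: sine_coeff_def set_lebesgue_integral_def mult.commute)
next
  case False
  define b where "b = real n"
  have b: "b > 0" using False by (simp add: b_def)
  define c where "c = b + 2"
  have c: "c > 0" using b by (simp add: c_def)
  define F where "F = (\<lambda>s. sin (b * s) / (2 * b) - sin (c * s) / (2 * c))"
  have "(\<integral>s. (1 * (sin s * sin (real (Suc n) * s))) * indicator {- pi..pi} s \<partial>lborel) = F pi - F (- pi)"
  proof (rule integral_FTC_Icc_real)
    fix s :: real
    have "b * s = (b + 1) * s - s" "c * s = (b + 1) * s + s"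
      by (simp_all add: c_def algebra_simps)
    then have "cos (b * s) - cos (c * s) = 2 * (sin s * sin ((b + 1) * s))"
      by (simp only: cos_diff cos_add) simp
    moreover have "DERIV F s :> cos (b * s) / 2 - cos (c * s) / 2"
      unfolding F_def using b c by (auto intro!: derivative_eq_intros)
    ultimately show "DERIV F s :> 1 * (sin s * sin (real (Suc n) * s))"
      by (simp add: b_def diff_divide_distrib[symmetric] add.commute)
  qed (auto intro!: continuous_intros)
  moreover have "sin (b * pi) = 0" "sin (c * pi) = 0"
    using sin_npi[of n] sin_npi[of "n + 2"] by (simp_all add: b_def c_def add.commute)
  ultimately show ?thesis
    using False by (simp add: sine_coeff_def set_lebesgue_integral_def F_def mult.commute)
qed

lemma sine_coeff_integrable:
  assumes "\<And>s. isCont f s"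
  shows "set_integrable lborel {- pi..pi} (\<lambda>s. f s * (sin s * sin (real (Suc n) * s)))"
  by (intro set_integrable_continuous_Icc continuous_intros assms)

text \<open>The sine of index 0 vanishes, so the lower neighbour is missing: this is the killing at
  -1.\<close>

lemma sine_coeff_cos_0:
  "sine_coeff (\<lambda>s. g * cos s * f s) 0 = g / 2 * sine_coeff f 1"
proof -
  have "(g * cos s * f s) * (sin s * sin (real (Suc 0) * s)) = g / 2 * (f s * (sin s * sin (real (Suc 1) * s)))" for s
    using sin_double[of s] by (simp add: mult_ac)
  then show ?thesis by (simp only: sine_coeff_def set_integral_mult_right) simp
qed

text \<open>By the addition theorem 2 cos s sin x = sin(x - s) + sin(x + s), multiplication by the
  cosine becomes a step to both neighbouring indices.\<close>

lemma sine_coeff_cos_Suc: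
  assumes "\<And>s. isCont f s"
  shows "sine_coeff (\<lambda>s. g * cos s * f s) (Suc n) = g / 2 * (sine_coeff f n + sine_coeff f (Suc (Suc n)))"
proof -
  have "(g * cos s * f s) * (sin s * sin (real (Suc (Suc n)) * s))
      = g / 2 * (f s * (sin s * sin (real (Suc n) * s)) + f s * (sin s * sin (real (Suc (Suc (Suc n))) * s)))" for s
  proof -
    define x where "x = real (Suc (Suc n)) * s"
    have x: "real (Suc n) * s = x - s" "real (Suc (Suc (Suc n))) * s = x + s"
      by (simp_all add: x_def algebra_simps)
    show ?thesis
      unfolding x unfolding x_def[symmetric] sin_diff sin_add by (simp add: algebra_simps)
  qed
  then show ?thesis
    by (simp only: sine_coeff_def set_integral_mult_right set_integral_add sine_coeff_integrable[OF assms])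
       (simp add: algebra_simps)
qed

text \<open>After the normalisation by \<open>q\<^bsup>n/2\<^esup>\<close>, the differences over two steps perform the simple random walk
  on the half-line killed at \<open>-1\<close>, which is diagonalised by sines.\<close>

lemma walk_diff_eq:
  assumes q: "q \<ge> 2"
  shows "sqrt (real q) ^ n * (walk q m n - walk q m (n + 2)) = sine_coeff (\<lambda>s. (tree_gamma q * cos s) ^ m) n"
proof (induction m arbitrary: n)
  case 0
  then show ?case by (simp add: sine_coeff_1 walk_0)
next
  case (Suc m)
  define r where "r = sqrt (real q)"
  have r: "r > 0" "real q = r * r" using q by (simp_all add: r_def)
  have r1: "r * r + 1 > 0" by (simp add: add_nonneg_pos)
  have g: "tree_gamma q / 2 = r / (r * r + 1)"
    using q by (simp add: tree_gamma_def r_def field_simps)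
  define w where "w = walk q m"
  have cont: "isCont (\<lambda>s. (tree_gamma q * cos s) ^ m) s" for s
    by (intro continuous_intros)
  define S where "S = sine_coeff (\<lambda>s. (tree_gamma q * cos s) ^ m)"
  have IH: "r ^ n * (w n - w (n + 2)) = S n" for n
    using Suc.IH[of n] by (simp only: r_def w_def S_def)
  show ?case
  proof (cases n)
    case 0
    have "sqrt (real q) ^ n * (walk q (Suc m) n - walk q (Suc m) (n + 2)) = w 1 - (w 1 + r * r * w 3) / (r * r + 1)"
      by (simp add: 0 walk_Suc w_def r(2) eval_nat_numeral)
    \<comment> \<open>The root averages to w 1 alone, so only the outward difference w 1 - w 3
      remains.\<close>
    also have "\<dots> = (r / (r * r + 1)) * (r * (w 1 - w 3))"
      using r1 by (simp add: field_simps)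
    also have "r * (w 1 - w 3) = S 1"
      using IH[of 1] by (simp add: eval_nat_numeral)
    also have "r / (r * r + 1) * S 1 = sine_coeff (\<lambda>s. (tree_gamma q * cos s) ^ Suc m) n"
      unfolding 0 g[symmetric] S_def using sine_coeff_cos_0[of "tree_gamma q" "\<lambda>s. (tree_gamma q * cos s) ^ m"] by simp
    finally show ?thesis .
  next
    case (Suc j)
    define a where "a = r ^ j"
    have "sqrt (real q) ^ n * (walk q (Suc m) n - walk q (Suc m) (n + 2))
        = r * a * ((w j + r * r * w (j+2)) / (r * r + 1) - (w (j+2) + r * r * w (j+4)) / (r * r + 1))"
      unfolding Suc r_def[symmetric] walk_Suc w_def[symmetric] by (simp add: a_def r(2) eval_nat_numeral)
    also have "\<dots> = (r / (r * r + 1)) * (a * (w j - w (j+2)) + r * r * a * (w (j+2) - w (j+4)))"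
    proof -
      have "r * a * ((x + r * r * y) / d - (y + r * r * z) / d) = (r / d) * (a * (x - y) + r * r * a * (y - z))"
        for x y z d :: real
        unfolding diff_divide_distrib[symmetric] by (simp only: times_divide_eq_left times_divide_eq_right) (simp add: algebra_simps)
      then show ?thesis .
    qed
    also have "a * (w j - w (j+2)) = S j"
      using IH[of j] by (simp add: a_def)
    also have "r * r * a * (w (j+2) - w (j+4)) = S (Suc (Suc j))"
      using IH[of "Suc (Suc j)"] by (simp add: a_def mult.assoc eval_nat_numeral)
    also have "r / (r * r + 1) * (S j + S (Suc (Suc j))) = sine_coeff (\<lambda>s. (tree_gamma q * cos s) ^ Suc m) n"
      unfolding Suc g[symmetric] S_def using sine_coeff_cos_Suc[OF cont, of "tree_gamma q" j] by simp
    finally show ?thesis .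
  qed
qed

text \<open>Sum \<open>walk_diff_eq\<close> against B: under the integral the series is the
  generating function at z = gamma cos s, and the interchange is dominated by B on a bounded
  interval.\<close>

lemma stable_walk_diff_eq:
  assumes q: "q \<ge> 2" and a: "0 < a" "a < 1" and t: "t > 0" and B: "discrete_stable a t B"
    and p: "\<And>n. (\<lambda>m. B m * walk q m n) sums p n"
  shows "sqrt (real q) ^ n * (p n - p (n + 2)) = sine_coeff (\<lambda>s. exp (- t * (1 - tree_gamma q * cos s) powr a)) n"
proof -
  note g = tree_gamma_bounds[OF q]
  note nonneg = discrete_stable_nonneg[OF a t B]
  define k where "k = (\<lambda>s. sin s * sin (real (Suc n) * s))"
  have k: "\<bar>k s\<bar> \<le> 1" for s
    unfolding k_def abs_mult by (intro mult_le_one) auto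
  have gc: "\<bar>tree_gamma q * cos s\<bar> \<le> 1" for s
    unfolding abs_mult using g by (intro mult_le_one) auto
  define f where "f = (\<lambda>m s. indicator {- pi..pi} s *\<^sub>R (B m * (tree_gamma q * cos s) ^ m * k s))"
  have int: "integrable lborel (f m)" for m
    using set_integrable_continuous_Icc[of "\<lambda>s. B m * (tree_gamma q * cos s) ^ m * k s" "- pi" pi]
    unfolding set_integrable_def f_def k_def by (simp add: continuous_intros)
  have bound: "norm (f m s) \<le> indicator {- pi..pi} s * B m" for m s
  proof -
    have "\<bar>B m * (tree_gamma q * cos s) ^ m * k s\<bar> = B m * (\<bar>tree_gamma q * cos s\<bar> ^ m * \<bar>k s\<bar>)"
      using nonneg by (simp add: abs_mult power_abs)
    also have "\<dots> \<le> B m * 1"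
      using k gc by (intro mult_left_mono mult_le_one power_le_one nonneg) auto
    finally show ?thesis by (simp add: f_def indicator_def)
  qed
  have Bs: "summable B" using discrete_stable_sums[OF B, of 1] by (simp add: sums_iff)
  have "(\<lambda>m. \<integral>s. f m s \<partial>lborel) sums (\<integral>s. (\<Sum>m. f m s) \<partial>lborel)"
  proof (rule sums_integral[OF int])
    show "AE s in lborel. summable (\<lambda>m. norm (f m s))"
    proof (rule AE_I2)
      fix s
      show "summable (\<lambda>m. norm (f m s))"
        by (rule summable_comparison_test[OF _ summable_mult[OF Bs, of "indicator {- pi..pi} s"]]) (use bound[of _ s] in auto)
    qed
    show "summable (\<lambda>m. \<integral>s. norm (f m s) \<partial>lborel)"
    proof (rule summable_comparison_test[OF _ summable_mult[OF Bs, of "2 * pi"]])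
      have "norm (\<integral>s. norm (f m s) \<partial>lborel) \<le> 2 * pi * B m" for m
      proof -
        have "(\<integral>s. norm (f m s) \<partial>lborel) \<le> (\<integral>s. indicator {- pi..pi} s * B m \<partial>lborel)"
          by (intro integral_mono bound integrable_norm int) (auto intro: integrable_mult_left)
        also have "\<dots> = 2 * pi * B m" by simp
        finally show ?thesis by simp
      qed
      then show "\<exists>N. \<forall>m\<ge>N. norm (\<integral>s. norm (f m s) \<partial>lborel) \<le> 2 * pi * B m" by blast
    qed
  qed
  then have "(\<lambda>m. 1 / pi * (\<integral>s. f m s \<partial>lborel)) sums (1 / pi * (\<integral>s. (\<Sum>m. f m s) \<partial>lborel))"
    by (rule sums_mult)
  moreover have "1 / pi * (\<integral>s. f m s \<partial>lborel) = B m * sine_coeff (\<lambda>s. (tree_gamma q * cos s) ^ m) n" for m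
  proof -
    have "(\<integral>s. f m s \<partial>lborel) = (LBINT s:{- pi..pi}. B m * ((tree_gamma q * cos s) ^ m * k s))"
      unfolding f_def set_lebesgue_integral_def by (simp only: mult.assoc)
    also have "\<dots> = B m * (LBINT s:{- pi..pi}. (tree_gamma q * cos s) ^ m * k s)"
      by (rule set_integral_mult_right)
    finally show ?thesis by (simp add: sine_coeff_def k_def)
  qed
  moreover have "1 / pi * (\<integral>s. (\<Sum>m. f m s) \<partial>lborel) = sine_coeff (\<lambda>s. exp (- t * (1 - tree_gamma q * cos s) powr a)) n"
  proof -
    have "(\<Sum>m. f m s) = indicator {- pi..pi} s *\<^sub>R (exp (- t * (1 - tree_gamma q * cos s) powr a) * k s)" for s
    proof -
      have "(\<lambda>m. indicator {- pi..pi} s * (B m * (tree_gamma q * cos s) ^ m) * k s)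
          sums (indicator {- pi..pi} s * exp (- t * (1 - tree_gamma q * cos s) powr a) * k s)"
        by (intro sums_mult2 sums_mult discrete_stable_sums[OF B] gc)
      then show ?thesis by (simp add: f_def sums_iff mult_ac)
    qed
    then show ?thesis by (simp add: sine_coeff_def set_lebesgue_integral_def k_def)
  qed
  moreover have "(\<lambda>m. sqrt (real q) ^ n * (B m * walk q m n - B m * walk q m (n + 2))) sums (sqrt (real q) ^ n * (p n - p (n + 2)))"
    by (intro sums_mult sums_diff p)
  moreover have "sqrt (real q) ^ n * (B m * walk q m n - B m * walk q m (n + 2)) = B m * sine_coeff (\<lambda>s. (tree_gamma q * cos s) ^ m) n" for m
    unfolding walk_diff_eq[OF q, symmetric] by (simp add: algebra_simps)
  ultimately show ?thesis by (simp add: sums_iff)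
qed

section \<open>Laplace's method\<close>

text \<open>With x = |s|/2 < 2, Taylor's formula gives sin x >= x - x^3/6 >= x/3, and 1 - cos s = 2
  (sin x)^2. Validity up to pi lets one Gaussian dominate the whole integrand.\<close>

lemma one_minus_cos_ge:
  fixes s :: real assumes "\<bar>s\<bar> \<le> pi" shows "s\<^sup>2 / 18 \<le> 1 - cos s"
proof -
  define x where "x = \<bar>s\<bar> / 2"
  have x: "0 \<le> x" "x < 2" using assms pi_half_less_two by (auto simp: x_def)
  have "\<bar>sin x - (\<Sum>m<3. sin_coeff m * x ^ m)\<bar> \<le> inverse (fact 3) * \<bar>x\<bar> ^ 3"
    by (rule Maclaurin_sin_bound)
  then have "\<bar>sin x - x\<bar> \<le> x ^ 3 / 6"
    using x by (simp add: sin_coeff_def eval_nat_numeral field_simps)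
  then have "x - x ^ 3 / 6 \<le> sin x" by linarith
  moreover have "x ^ 3 \<le> 4 * x"
  proof -
    have "x * x \<le> 2 * 2" using x by (intro mult_mono) auto
    then have "(x * x) * x \<le> 4 * x" using x by (intro mult_right_mono) auto
    then show ?thesis by (simp add: power3_eq_cube)
  qed
  ultimately have "x / 3 \<le> sin x" by linarith
  then have "(x / 3)\<^sup>2 \<le> (sin x)\<^sup>2" using x by (intro power_mono) auto
  moreover have "cos s = 1 - 2 * (sin x)\<^sup>2"
    using cos_double_sin[of x] by (simp add: x_def)
  moreover have "s\<^sup>2 = 4 * x\<^sup>2" by (simp add: x_def power_divide)
  ultimately show ?thesis by (simp add: power_divide)
qed

text \<open>By concavity the graph lies below its tangent at the right end z = x + y, whose slope a
  z^(a-1) is at least a/2 because z <= 2.\<close>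

lemma powr_increment_ge:
  fixes x y a :: real
  assumes "0 < x" "0 \<le> y" "x + y \<le> 2" "0 < a" "a < 1"
  shows "a / 2 * y \<le> (x + y) powr a - x powr a"
proof -
  define z where "z = x + y"
  have z: "0 < z" "z \<le> 2" using assms by (simp_all add: z_def)
  have "(x / z) powr a \<le> 1 + a * (x / z - 1)"
    using assms z by (intro powr_le_linear) auto
  then have "z powr a * (x / z) powr a \<le> z powr a * (1 + a * (x / z - 1))"
    by (intro mult_left_mono) auto
  also have "z powr a * (x / z) powr a = x powr a"
    using z assms by (simp add: powr_divide)
  also have "z powr a * (1 + a * (x / z - 1)) = z powr a - a * y * (z powr a / z)"
    using z by (simp add: z_def[symmetric] field_simps) (simp add: z_def algebra_simps)
  finally have "a * y * (z powr a / z) \<le> z powr a - x powr a" by simp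
  moreover have "1 / 2 \<le> z powr a / z"
  proof -
    have "(1 / 2) powr 1 \<le> (1 / z) powr (1 - a)"
    proof -
      have "(1 / 2 :: real) powr 1 \<le> (1 / 2) powr (1 - a)" using assms by (intro powr_mono') auto
      also have "\<dots> \<le> (1 / z) powr (1 - a)" using z assms by (intro powr_mono2) (auto simp: field_simps)
      finally show ?thesis .
    qed
    also have "(1 / z) powr (1 - a) = z powr a / z"
      using z by (simp add: powr_divide powr_diff)
    finally show ?thesis by simp
  qed
  then have "a * y * (1 / 2) \<le> a * y * (z powr a / z)"
    using assms by (intro mult_left_mono) auto
  ultimately have "a * y * (1 / 2) \<le> z powr a - x powr a" by linarith
  then show ?thesis by (simp add: z_def)
qed

section \<open>Gaussian integrals\<close>

lemma integrable_gaussian_moment: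
  fixes c :: real assumes "c > 0"
  shows "integrable lborel (\<lambda>x. x ^ k * exp (- c * x\<^sup>2))"
proof -
  define \<sigma> where "\<sigma> = 1 / sqrt (2 * c)"
  have \<sigma>: "\<sigma> > 0" using assms by (simp add: \<sigma>_def)
  have s2: "2 * \<sigma>\<^sup>2 = 1 / c" using assms by (simp add: \<sigma>_def power_divide)
  have *: "- x\<^sup>2 / (2 * \<sigma>\<^sup>2) = - c * x\<^sup>2" for x unfolding s2 by simp
  have "integrable lborel (\<lambda>x. sqrt (2 * pi * \<sigma>\<^sup>2) * (normal_density 0 \<sigma> x * (x - 0) ^ k))"
    using \<sigma> by (intro integrable_mult_right integrable_normal_moment) auto
  moreover have "(\<lambda>x. sqrt (2 * pi * \<sigma>\<^sup>2) * (normal_density 0 \<sigma> x * (x - 0) ^ k)) = (\<lambda>x. x ^ k * exp (- c * x\<^sup>2))"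
    unfolding normal_density_def diff_zero * using \<sigma> by (simp add: fun_eq_iff)
  ultimately show ?thesis by (simp only:)
qed

text \<open>Real part of the characteristic function of the standard normal law.\<close>

lemma gaussian_cos_integral:
  "integrable lborel (\<lambda>x. exp (- x\<^sup>2 / 2) * cos (k * x))"
  "(\<integral>x. exp (- x\<^sup>2 / 2) * cos (k * x) \<partial>lborel) = sqrt (2 * pi) * exp (- k\<^sup>2 / 2)"
proof -
  interpret real_distribution std_normal_distribution by (rule real_dist_normal_dist)
  have int: "integrable std_normal_distribution (\<lambda>x. iexp (k * x))"
    by (rule integrable_const_bound[where B=1]) auto
  have "complex_of_real (exp (- k\<^sup>2 / 2)) = (CLINT x|std_normal_distribution. iexp (k * x))"
    using char_std_normal_distribution by (simp add: char_def fun_eq_iff)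
  then have "exp (- k\<^sup>2 / 2) = Re (CLINT x|std_normal_distribution. iexp (k * x))"
    by (metis Re_complex_of_real)
  also have "\<dots> = (\<integral>x. Re (iexp (k * x)) \<partial>std_normal_distribution)"
    by (rule integral_Re[symmetric, OF int])
  also have "\<dots> = (\<integral>x. cos (k * x) \<partial>std_normal_distribution)"
    by (simp add: Re_exp)
  also have "\<dots> = (\<integral>x. std_normal_density x *\<^sub>R cos (k * x) \<partial>lborel)"
    by (rule integral_density) (auto simp: normal_density_nonneg)
  also have "\<dots> = (\<integral>x. (1 / sqrt (2 * pi)) * (exp (- x\<^sup>2 / 2) * cos (k * x)) \<partial>lborel)"
    by (simp add: std_normal_density_def)
  also have "\<dots> = (1 / sqrt (2 * pi)) * (\<integral>x. exp (- x\<^sup>2 / 2) * cos (k * x) \<partial>lborel)"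
    by (rule integral_mult_right_zero)
  finally show "(\<integral>x. exp (- x\<^sup>2 / 2) * cos (k * x) \<partial>lborel) = sqrt (2 * pi) * exp (- k\<^sup>2 / 2)"
    by (simp add: field_simps)
  show "integrable lborel (\<lambda>x. exp (- x\<^sup>2 / 2) * cos (k * x))"
  proof (rule Bochner_Integration.integrable_bound)
    show "integrable lborel (\<lambda>x :: real. x ^ 0 * exp (- (1 / 2) * x\<^sup>2))"
      by (rule integrable_gaussian_moment) simp
    show "AE x in lborel. norm (exp (- x\<^sup>2 / 2) * cos (k * x)) \<le> norm (x ^ 0 * exp (- (1 / 2) * x\<^sup>2))"
      by (intro AE_I2) (auto simp: abs_mult mult_le_cancel_left2)
  qed simp
qed

text \<open>Integration by parts reduces this to the cosine integral; the boundary terms vanish at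
  both infinities.\<close>

lemma gaussian_sin_integral:
  "integrable lborel (\<lambda>x. x * exp (- x\<^sup>2 / 2) * sin (k * x))"
  "(\<integral>x. x * exp (- x\<^sup>2 / 2) * sin (k * x) \<partial>lborel) = k * (sqrt (2 * pi) * exp (- k\<^sup>2 / 2))"
proof -
  define F where "F = (\<lambda>x. - exp (- x\<^sup>2 / 2) * sin (k * x))"
  define f where "f = (\<lambda>x. x * exp (- x\<^sup>2 / 2) * sin (k * x) - k * (exp (- x\<^sup>2 / 2) * cos (k * x)))"
  show 1: "integrable lborel (\<lambda>x. x * exp (- x\<^sup>2 / 2) * sin (k * x))"
  proof (rule Bochner_Integration.integrable_bound)
    show "integrable lborel (\<lambda>x :: real. x ^ 1 * exp (- (1 / 2) * x\<^sup>2))"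
      by (rule integrable_gaussian_moment) simp
    show "AE x in lborel. norm (x * exp (- x\<^sup>2 / 2) * sin (k * x)) \<le> norm (x ^ 1 * exp (- (1 / 2) * x\<^sup>2))"
      by (intro AE_I2) (auto simp: abs_mult intro!: mult_left_le)
  qed simp
  note 2 = gaussian_cos_integral[of k]
  have f: "integrable lborel f"
    unfolding f_def by (intro Bochner_Integration.integrable_diff 1 integrable_mult_right 2)
  have lim: "((\<lambda>x. - exp (- x\<^sup>2 / 2) * sin (k * x)) \<longlongrightarrow> 0) l" if "l = at_top \<or> l = at_bot" for l :: "real filter"
  proof (rule Lim_null_comparison)
    show "\<forall>\<^sub>F x in l. norm (- exp (- x\<^sup>2 / 2) * sin (k * x)) \<le> exp (- x\<^sup>2 / 2)"
      by (intro always_eventually allI) (simp add: abs_mult mult_le_cancel_left2)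
    have "((\<lambda>x :: real. exp (- x\<^sup>2 / 2)) \<longlongrightarrow> 0) at_top"
      by real_asymp
    moreover have "((\<lambda>x :: real. exp (- x\<^sup>2 / 2)) \<longlongrightarrow> 0) at_bot"
      by real_asymp
    ultimately show "((\<lambda>x :: real. exp (- x\<^sup>2 / 2)) \<longlongrightarrow> 0) l" using that by auto
  qed
  have "(LBINT x=-\<infinity>..\<infinity>. f x) = 0 - 0"
  proof (rule interval_integral_FTC_integrable[where F=F])
    show "(F has_vector_derivative f x) (at x)" for x
      unfolding F_def f_def has_real_derivative_iff_has_vector_derivative[symmetric]
      by (auto intro!: derivative_eq_intros simp: algebra_simps)
    show "isCont f x" for x unfolding f_def by (intro continuous_intros) simp_all
    show "set_integrable lborel (einterval (- \<infinity>) \<infinity>) f"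
      using f by (simp add: set_integrable_def)
    show "((F \<circ> real_of_ereal) \<longlongrightarrow> 0) (at_right (- \<infinity>))"
      unfolding ereal_tendsto_simps1 F_def by (rule lim) simp
    show "((F \<circ> real_of_ereal) \<longlongrightarrow> 0) (at_left \<infinity>)"
      unfolding ereal_tendsto_simps1 F_def by (rule lim) simp
  qed auto
  then have "(\<integral>x. f x \<partial>lborel) = 0"
    by (simp add: interval_integral_to_infinity_eq interval_lebesgue_integral_def set_lebesgue_integral_def)
  also have "(\<integral>x. f x \<partial>lborel) = (\<integral>x. x * exp (- x\<^sup>2 / 2) * sin (k * x) \<partial>lborel)
      - (\<integral>x. k * (exp (- x\<^sup>2 / 2) * cos (k * x)) \<partial>lborel)"
    unfolding f_def by (rule Bochner_Integration.integral_diff[OF 1 integrable_mult_right[OF 2(1)]])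
  also have "(\<integral>x. k * (exp (- x\<^sup>2 / 2) * cos (k * x)) \<partial>lborel) = k * (\<integral>x. exp (- x\<^sup>2 / 2) * cos (k * x) \<partial>lborel)"
    by (rule integral_mult_right_zero)
  finally show "(\<integral>x. x * exp (- x\<^sup>2 / 2) * sin (k * x) \<partial>lborel) = k * (sqrt (2 * pi) * exp (- k\<^sup>2 / 2))"
    using 2(2) by simp
qed

lemma tendsto_mult_sin_divide: "((\<lambda>r. r * sin (c / r)) \<longlongrightarrow> c) at_top" for c :: real
proof (cases "c = 0")
  case False
  then consider "c > 0" | "c < 0" by linarith
  then show ?thesis by cases real_asymp+
qed simp

lemma sin_divide_bound: "k > 0 \<Longrightarrow> \<bar>sin (k * x) / k\<bar> \<le> \<bar>x\<bar>" for k x :: real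
  using abs_sin_x_le_abs_x[of "k * x"] by (simp add: abs_mult divide_le_eq mult.commute)

section \<open>Dominated convergence for the rescaled sine integral\<close>

context
  fixes a g :: real
  assumes a: "0 < a" "a < 1" and g: "0 < g" "g < 1"
begin

text \<open>The exponent minus its minimum, attained at s = 0; this splits off the factor exp(-t (1
  - g)^a).\<close>

definition symbol :: "real \<Rightarrow> real" where
  "symbol s = (1 - g * cos s) powr a - (1 - g) powr a"

text \<open>Second derivative of \<open>symbol\<close> at \<open>0\<close>.\<close>

definition curv :: real where "curv = a * g * (1 - g) powr (a - 1)"

lemma curv_pos: "curv > 0"
  using a g by (simp add: curv_def)

lemma symbol_ge: assumes "\<bar>s\<bar> \<le> pi" shows "a * g / 36 * s\<^sup>2 \<le> symbol s"
proof -
  have "g * (1 - cos s) \<le> g * 2"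
    using g by (intro mult_left_mono) auto
  moreover have "g * cos s \<ge> - 1"
    using g mult_left_mono[of "- 1" "cos s" g] by simp
  ultimately have "a / 2 * (g * (1 - cos s)) \<le> (1 - g + g * (1 - cos s)) powr a - (1 - g) powr a"
    using a g by (intro powr_increment_ge) (auto simp: algebra_simps)
  also have "\<dots> = symbol s" by (simp add: symbol_def algebra_simps)
  also have "a / 2 * (g * (1 - cos s)) \<ge> a / 2 * (g * (s\<^sup>2 / 18))"
    using one_minus_cos_ge[OF assms] a g by (intro mult_left_mono) auto
  finally show ?thesis by simp
qed

lemma symbol_limit: "((\<lambda>r. r\<^sup>2 / curv * symbol (x / r)) \<longlongrightarrow> x\<^sup>2 / 2) at_top"
proof -
  define y where "y = 1 - g"
  have y: "y > 0" using g by (simp add: y_def)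
  have "((\<lambda>z. z powr a) has_real_derivative a * y powr (a - 1)) (at y)"
    using y by (auto intro!: derivative_eq_intros)
  \<comment> \<open>In Caratheodory's form of the derivative the increment of z^a is an exact
    product, so only the elementary limit of r^2 (1 - cos(x/r)) is left and no second-order
    expansion is needed.\<close>
  then obtain G where G: "\<And>z. z powr a - y powr a = G z * (z - y)" "isCont G y" "G y = a * y powr (a - 1)"
    unfolding DERIV_caratheodory_within by auto
  have cos_eq: "1 - cos (x / r) = 2 * (sin ((x / 2) / r))\<^sup>2" for r
    using cos_double_sin[of "(x / 2) / r"] by simp
  have "((\<lambda>r. 2 * (r * sin ((x / 2) / r))\<^sup>2) \<longlongrightarrow> 2 * (x / 2)\<^sup>2) at_top"
    by (intro tendsto_intros tendsto_mult_sin_divide)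
  then have lim: "((\<lambda>r. r\<^sup>2 * (1 - cos (x / r))) \<longlongrightarrow> x\<^sup>2 / 2) at_top"
    by (simp add: cos_eq power_mult_distrib power_divide mult_ac)
  have "((\<lambda>r. x / r) \<longlongrightarrow> 0) at_top"
    by (rule real_tendsto_divide_at_top[OF tendsto_const filterlim_ident])
  then have "((\<lambda>r. 1 - g * cos (x / r)) \<longlongrightarrow> 1 - g * cos 0) at_top"
    by (intro tendsto_intros)
  then have "((\<lambda>r. 1 - g * cos (x / r)) \<longlongrightarrow> y) at_top"
    by (simp add: y_def)
  then have "((\<lambda>r. G (1 - g * cos (x / r))) \<longlongrightarrow> G y) at_top"
    by (rule isCont_tendsto_compose[OF G(2)])
  then have L: "((\<lambda>r. g / curv * G (1 - g * cos (x / r)) * (r\<^sup>2 * (1 - cos (x / r)))) \<longlongrightarrow> g / curv * G y * (x\<^sup>2 / 2)) at_top"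
    by (intro tendsto_mult tendsto_const lim)
  have e1: "g / curv * G y = 1"
    using a g y by (simp add: G(3) curv_def y_def[symmetric])
  have e2: "g / curv * G (1 - g * cos (x / r)) * (r\<^sup>2 * (1 - cos (x / r))) = r\<^sup>2 / curv * symbol (x / r)" for r
  proof -
    have "symbol (x / r) = G (1 - g * cos (x / r)) * (g * (1 - cos (x / r)))"
      unfolding symbol_def y_def[symmetric] G(1) by (simp add: y_def algebra_simps)
    then show ?thesis by (simp add: mult_ac)
  qed
  show ?thesis using L unfolding e1 e2 by simp
qed

text \<open>The substitution \<open>s = x / r\<close> with \<open>r = sqrt (t * curv)\<close> makes \<open>x exp (- x\<^sup>2 / 2)\<close> the limit of the
  integrand as \<open>t \<rightarrow> \<infinity>\<close>.\<close>

definition profile :: "real \<Rightarrow> real \<Rightarrow> real" where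
  "profile r x = indicator {- (pi * r)..pi * r} x * (exp (- (r\<^sup>2 / curv * symbol (x / r))) * (r * sin (x / r)))"

text \<open>The constant of \<open>symbol_ge\<close> after rescaling: one Gaussian with this rate
  dominates \<open>profile r\<close> for every r > 0.\<close>

definition rate :: real where "rate = a * g / 36 / curv"

lemma rate_pos: "rate > 0"
  using a g curv_pos by (simp add: rate_def)

lemma profile_bound:
  assumes "r > 0" shows "\<bar>profile r x\<bar> \<le> \<bar>x\<bar> * exp (- rate * x\<^sup>2)"
proof (cases "x \<in> {- (pi * r)..pi * r}")
  case True
  then have "\<bar>x / r\<bar> \<le> pi" using assms by (simp add: abs_le_iff field_simps)
  then have "r\<^sup>2 / curv * (a * g / 36 * (x / r)\<^sup>2) \<le> r\<^sup>2 / curv * symbol (x / r)"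
    using curv_pos by (intro mult_left_mono symbol_ge) auto
  also have "r\<^sup>2 / curv * (a * g / 36 * (x / r)\<^sup>2) = rate * x\<^sup>2"
    using assms by (simp add: rate_def power_divide)
  finally have 1: "exp (- (r\<^sup>2 / curv * symbol (x / r))) \<le> exp (- rate * x\<^sup>2)" by simp
  have "r * \<bar>sin (x / r)\<bar> \<le> r * \<bar>x / r\<bar>"
    using assms by (intro mult_left_mono abs_sin_x_le_abs_x) auto
  then have 2: "r * \<bar>sin (x / r)\<bar> \<le> \<bar>x\<bar>" using assms by simp
  have "\<bar>profile r x\<bar> = exp (- (r\<^sup>2 / curv * symbol (x / r))) * (r * \<bar>sin (x / r)\<bar>)"
    using True assms by (simp add: profile_def abs_mult)
  also have "\<dots> \<le> exp (- rate * x\<^sup>2) * \<bar>x\<bar>"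
    using 1 2 assms by (intro mult_mono) auto
  finally show ?thesis by (simp add: mult.commute)
qed (simp add: profile_def)

lemma profile_limit: "((\<lambda>r. profile r x) \<longlongrightarrow> x * exp (- x\<^sup>2 / 2)) at_top"
proof -
  have "((\<lambda>r. exp (- (r\<^sup>2 / curv * symbol (x / r))) * (r * sin (x / r))) \<longlongrightarrow> exp (- (x\<^sup>2 / 2)) * x) at_top"
    by (intro tendsto_intros symbol_limit tendsto_mult_sin_divide)
  moreover have "\<forall>\<^sub>F r in at_top. exp (- (r\<^sup>2 / curv * symbol (x / r))) * (r * sin (x / r)) = profile r x"
    using eventually_ge_at_top[of "\<bar>x\<bar> / pi"]
  proof eventually_elim
    case (elim r)
    then have "\<bar>x\<bar> \<le> pi * r" by (simp add: divide_le_eq mult.commute)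
    then show ?case by (simp add: profile_def indicator_def abs_le_iff)
  qed
  ultimately have "((\<lambda>r. profile r x) \<longlongrightarrow> exp (- (x\<^sup>2 / 2)) * x) at_top"
    by (rule Lim_transform_eventually)
  then show ?thesis by (simp add: mult.commute)
qed

lemma profile_measurable [measurable]: "profile r \<in> borel_measurable borel"
  unfolding profile_def symbol_def by measurable

text \<open>The factor r^(-3) collects 1/r from ds, from sin s, and from k = (n+1)/r. Taking k out
  leaves \<open>sin (k * x) / k\<close>, which is at most |x| in absolute value, so all later
  estimates are uniform in n.\<close>

lemma sine_coeff_rescale:
  fixes n :: nat
  assumes r: "r > 0"
  defines "k \<equiv> real (Suc n) / r"
  shows "sine_coeff (\<lambda>s. exp (- (r\<^sup>2 / curv) * (1 - g * cos s) powr a)) n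
    = exp (- (r\<^sup>2 / curv) * (1 - g) powr a) * real (Suc n) / (pi * r ^ 3) * (\<integral>x. profile r x * (sin (k * x) / k) \<partial>lborel)"
proof -
  define T where "T = r\<^sup>2 / curv"
  have k: "k > 0" using r by (simp add: k_def)
  define f where "f = (\<lambda>s. indicator {- pi..pi} s *\<^sub>R (exp (- T * (1 - g * cos s) powr a) * (sin s * sin (real (Suc n) * s))))"
  have f_eq: "f (0 + 1 / r * x) = exp (- T * (1 - g) powr a) * k / r * (profile r x * (sin (k * x) / k))" for x
  proof -
    have "indicator {- pi..pi} (x / r) = (indicator {- (pi * r)..pi * r} x :: real)"
      using r by (auto simp: indicator_def field_simps)
    moreover have "exp (- T * (1 - g * cos (x / r)) powr a) = exp (- T * (1 - g) powr a) * exp (- (T * symbol (x / r)))"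
      by (simp add: mult_exp_exp symbol_def algebra_simps)
    moreover have "real (Suc n) * (x / r) = k * x" by (simp add: k_def)
    ultimately show ?thesis
      using k r by (simp add: f_def profile_def T_def[symmetric])
  qed
  have "sine_coeff (\<lambda>s. exp (- T * (1 - g * cos s) powr a)) n = 1 / pi * (\<integral>s. f s \<partial>lborel)"
    by (simp add: sine_coeff_def set_lebesgue_integral_def f_def)
  also have "(\<integral>s. f s \<partial>lborel) = \<bar>1 / r\<bar> *\<^sub>R (\<integral>x. f (0 + 1 / r * x) \<partial>lborel)"
    using r by (intro lborel_integral_real_affine) simp
  also have "(\<integral>x. f (0 + 1 / r * x) \<partial>lborel)
      = exp (- T * (1 - g) powr a) * k / r * (\<integral>x. profile r x * (sin (k * x) / k) \<partial>lborel)"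
    unfolding f_eq by (rule integral_mult_right_zero)
  finally show ?thesis
    using r by (simp add: T_def k_def power3_eq_cube mult_ac)
qed

lemma profile_sin_bound:
  assumes "r > 0" "k > 0"
  shows "\<bar>profile r x * (sin (k * x) / k)\<bar> \<le> x ^ 2 * exp (- rate * x\<^sup>2)"
proof -
  have "\<bar>profile r x * (sin (k * x) / k)\<bar> \<le> (\<bar>x\<bar> * exp (- rate * x\<^sup>2)) * \<bar>x\<bar>"
    unfolding abs_mult[of "profile r x"]
    by (intro mult_mono profile_bound sin_divide_bound assms) auto
  also have "\<dots> = x ^ 2 * exp (- rate * x\<^sup>2)"
    by (simp add: power2_eq_square mult_ac)
  finally show ?thesis .
qed

lemma profile_sin_integrable:
  assumes "r > 0" "k > 0" shows "integrable lborel (\<lambda>x. profile r x * (sin (k * x) / k))"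
proof (rule Bochner_Integration.integrable_bound[OF integrable_gaussian_moment[OF rate_pos, of 2]])
  show "AE x in lborel. norm (profile r x * (sin (k * x) / k)) \<le> norm (x ^ 2 * exp (- rate * x\<^sup>2))"
    using profile_sin_bound[OF assms] by (intro AE_I2) simp
qed measurable

lemma profile_integral_le:
  assumes "r > 0" "k > 0"
  shows "\<bar>\<integral>x. profile r x * (sin (k * x) / k) \<partial>lborel\<bar> \<le> (\<integral>x. x ^ 2 * exp (- rate * x\<^sup>2) \<partial>lborel)"
proof -
  have "\<bar>\<integral>x. profile r x * (sin (k * x) / k) \<partial>lborel\<bar> \<le> (\<integral>x. \<bar>profile r x * (sin (k * x) / k)\<bar> \<partial>lborel)"
    by (rule integral_abs_bound)
  also have "\<dots> \<le> (\<integral>x. x ^ 2 * exp (- rate * x\<^sup>2) \<partial>lborel)"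
    by (intro integral_mono integrable_abs profile_sin_integrable integrable_gaussian_moment rate_pos
        profile_sin_bound assms)
  finally show ?thesis .
qed

lemma profile_diff_bound:
  assumes "r > 0"
  shows "\<bar>profile r x - x * exp (- x\<^sup>2 / 2)\<bar> * \<bar>x\<bar> \<le> x ^ 2 * exp (- rate * x\<^sup>2) + x ^ 2 * exp (- (1 / 2) * x\<^sup>2)"
proof -
  have "\<bar>profile r x - x * exp (- x\<^sup>2 / 2)\<bar> \<le> \<bar>x\<bar> * exp (- rate * x\<^sup>2) + \<bar>x\<bar> * exp (- (1 / 2) * x\<^sup>2)"
    using profile_bound[OF assms, of x] abs_triangle_ineq4[of "profile r x" "x * exp (- x\<^sup>2 / 2)"]
    by (simp add: abs_mult)
  then have "\<bar>profile r x - x * exp (- x\<^sup>2 / 2)\<bar> * \<bar>x\<bar>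
      \<le> (\<bar>x\<bar> * exp (- rate * x\<^sup>2) + \<bar>x\<bar> * exp (- (1 / 2) * x\<^sup>2)) * \<bar>x\<bar>"
    by (intro mult_right_mono) auto
  also have "\<dots> = x ^ 2 * exp (- rate * x\<^sup>2) + x ^ 2 * exp (- (1 / 2) * x\<^sup>2)"
    by (simp add: power2_eq_square algebra_simps)
  finally show ?thesis .
qed

lemma profile_L1_limit: "((\<lambda>r. \<integral>x. \<bar>profile r x - x * exp (- x\<^sup>2 / 2)\<bar> * \<bar>x\<bar> \<partial>lborel) \<longlongrightarrow> 0) at_top"
proof -
  define w where "w = (\<lambda>x. x ^ 2 * exp (- rate * x\<^sup>2) + x ^ 2 * exp (- (1 / 2) * x\<^sup>2))"
  have "((\<lambda>r. \<integral>x. \<bar>profile r x - x * exp (- x\<^sup>2 / 2)\<bar> * \<bar>x\<bar> \<partial>lborel) \<longlongrightarrow> (\<integral>x. 0 \<partial>(lborel :: real measure))) at_top"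
  proof (rule integral_dominated_convergence_at_top[where w=w])
    show "integrable lborel w"
      unfolding w_def by (intro Bochner_Integration.integrable_add integrable_gaussian_moment rate_pos) simp
    show "AE x in lborel. ((\<lambda>r. \<bar>profile r x - x * exp (- x\<^sup>2 / 2)\<bar> * \<bar>x\<bar>) \<longlongrightarrow> 0) at_top"
    proof (rule AE_I2)
      fix x :: real
      have "((\<lambda>r. \<bar>profile r x - x * exp (- x\<^sup>2 / 2)\<bar> * \<bar>x\<bar>) \<longlongrightarrow> \<bar>x * exp (- x\<^sup>2 / 2) - x * exp (- x\<^sup>2 / 2)\<bar> * \<bar>x\<bar>) at_top"
        by (intro tendsto_mult tendsto_rabs tendsto_diff profile_limit tendsto_const)
      then show "((\<lambda>r. \<bar>profile r x - x * exp (- x\<^sup>2 / 2)\<bar> * \<bar>x\<bar>) \<longlongrightarrow> 0) at_top" by simp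
    qed
    show "\<forall>\<^sub>F r in at_top. AE x in lborel. norm (\<bar>profile r x - x * exp (- x\<^sup>2 / 2)\<bar> * \<bar>x\<bar>) \<le> w x"
      using eventually_gt_at_top[of 0]
    proof eventually_elim
      case (elim r)
      show ?case
        using profile_diff_bound[OF elim] by (intro AE_I2) (simp add: w_def)
    qed
  qed measurable
  then show ?thesis by simp
qed

text \<open>The weight |x| majorises |sin(kx)/k|, so the error does not depend on k and one
  threshold for r serves all n.\<close>

lemma profile_integral_ge:
  assumes "r > 0" "k > 0"
  shows "sqrt (2 * pi) * exp (- k\<^sup>2 / 2) - (\<integral>x. \<bar>profile r x - x * exp (- x\<^sup>2 / 2)\<bar> * \<bar>x\<bar> \<partial>lborel)
    \<le> (\<integral>x. profile r x * (sin (k * x) / k) \<partial>lborel)"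
proof -
  note int1 = profile_sin_integrable[OF assms]
  have int2: "integrable lborel (\<lambda>x. x * exp (- x\<^sup>2 / 2) * (sin (k * x) / k))"
    using integrable_divide_zero[OF gaussian_sin_integral(1)[of k], of k] by simp
  have "(\<integral>x. x * exp (- x\<^sup>2 / 2) * (sin (k * x) / k) \<partial>lborel) = (\<integral>x. x * exp (- x\<^sup>2 / 2) * sin (k * x) / k \<partial>lborel)"
    by simp
  also have "\<dots> = (\<integral>x. x * exp (- x\<^sup>2 / 2) * sin (k * x) \<partial>lborel) / k"
    by (rule integral_divide_zero)
  also have "\<dots> = sqrt (2 * pi) * exp (- k\<^sup>2 / 2)"
    unfolding gaussian_sin_integral(2) using assms by simp
  finally have main: "(\<integral>x. x * exp (- x\<^sup>2 / 2) * (sin (k * x) / k) \<partial>lborel) = sqrt (2 * pi) * exp (- k\<^sup>2 / 2)" .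
  have "(\<integral>x. x * exp (- x\<^sup>2 / 2) * (sin (k * x) / k) \<partial>lborel) - (\<integral>x. profile r x * (sin (k * x) / k) \<partial>lborel)
      = (\<integral>x. x * exp (- x\<^sup>2 / 2) * (sin (k * x) / k) - profile r x * (sin (k * x) / k) \<partial>lborel)"
    by (rule Bochner_Integration.integral_diff[symmetric, OF int2 int1])
  also have "\<dots> \<le> (\<integral>x. \<bar>profile r x - x * exp (- x\<^sup>2 / 2)\<bar> * \<bar>x\<bar> \<partial>lborel)"
  proof (rule integral_mono)
    show "integrable lborel (\<lambda>x. x * exp (- x\<^sup>2 / 2) * (sin (k * x) / k) - profile r x * (sin (k * x) / k))"
      by (intro Bochner_Integration.integrable_diff int1 int2)
    show "integrable lborel (\<lambda>x. \<bar>profile r x - x * exp (- x\<^sup>2 / 2)\<bar> * \<bar>x\<bar>)"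
    proof (rule Bochner_Integration.integrable_bound)
      show "integrable lborel (\<lambda>x. x ^ 2 * exp (- rate * x\<^sup>2) + x ^ 2 * exp (- (1 / 2) * x\<^sup>2))"
        by (intro Bochner_Integration.integrable_add integrable_gaussian_moment rate_pos) simp
      show "AE x in lborel. norm (\<bar>profile r x - x * exp (- x\<^sup>2 / 2)\<bar> * \<bar>x\<bar>) \<le> norm (x ^ 2 * exp (- rate * x\<^sup>2) + x ^ 2 * exp (- (1 / 2) * x\<^sup>2))"
        using profile_diff_bound[OF assms(1)] by (intro AE_I2) simp
    qed measurable
    fix x :: real
    have "x * exp (- x\<^sup>2 / 2) * (sin (k * x) / k) - profile r x * (sin (k * x) / k)
        = - (profile r x - x * exp (- x\<^sup>2 / 2)) * (sin (k * x) / k)"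
      by (simp add: algebra_simps)
    also have "\<dots> \<le> \<bar>- (profile r x - x * exp (- x\<^sup>2 / 2)) * (sin (k * x) / k)\<bar>"
      by (rule abs_ge_self)
    also have "\<dots> = \<bar>profile r x - x * exp (- x\<^sup>2 / 2)\<bar> * \<bar>sin (k * x) / k\<bar>"
      by (simp only: abs_mult abs_minus_cancel)
    also have "\<dots> \<le> \<bar>profile r x - x * exp (- x\<^sup>2 / 2)\<bar> * \<bar>x\<bar>"
      using assms by (intro mult_left_mono sin_divide_bound) auto
    finally show "x * exp (- x\<^sup>2 / 2) * (sin (k * x) / k) - profile r x * (sin (k * x) / k)
        \<le> \<bar>profile r x - x * exp (- x\<^sup>2 / 2)\<bar> * \<bar>x\<bar>" .
  qed
  finally show ?thesis unfolding main by simp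
qed

end

lemma powr_minus_three_halves: "t > 0 \<Longrightarrow> t powr (- 3 / 2) = 1 / sqrt t ^ 3" for t :: real
proof -
  assume t: "t > 0"
  have "sqrt t ^ 3 = t powr (3 / 2)"
    using t powr_power[of t "1 / 2" 3] by (simp add: powr_half_sqrt)
  moreover have "t powr (- 3 / 2) = inverse (t powr (3 / 2))"
    using powr_minus[of t "3 / 2"] by simp
  ultimately show ?thesis by (simp add: inverse_eq_divide)
qed

context
  fixes a g :: real
  assumes a: "0 < a" "a < 1" and g: "0 < g" "g < 1"
begin

lemma sine_coeff_stable_eq:
  fixes n :: nat
  assumes t: "t > 0"
  defines "r \<equiv> sqrt (t * curv a g)"
  defines "k \<equiv> real (Suc n) / r"
  shows "sine_coeff (\<lambda>s. exp (- t * (1 - g * cos s) powr a)) n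
    = real (Suc n) * (t powr (- 3 / 2) * exp (- t * (1 - g) powr a)) / (pi * sqrt (curv a g) ^ 3)
      * (\<integral>x. profile a g r x * (sin (k * x) / k) \<partial>lborel)"
proof -
  have c: "curv a g > 0" by (rule curv_pos[OF a g])
  have r: "r > 0" "r\<^sup>2 / curv a g = t" using t c by (simp_all add: r_def)
  define I where "I = (\<integral>x. profile a g r x * (sin (k * x) / k) \<partial>lborel)"
  have r3: "r ^ 3 = sqrt t ^ 3 * sqrt (curv a g) ^ 3"
    by (simp add: r_def real_sqrt_mult power_mult_distrib)
  have "sine_coeff (\<lambda>s. exp (- t * (1 - g * cos s) powr a)) n = exp (- t * (1 - g) powr a) * real (Suc n) / (pi * r ^ 3) * I"
    using sine_coeff_rescale[OF a g r(1), of n] unfolding r(2) k_def[symmetric] I_def .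
  also have "\<dots> = real (Suc n) * (t powr (- 3 / 2) * exp (- t * (1 - g) powr a)) / (pi * sqrt (curv a g) ^ 3) * I"
    unfolding r3 powr_minus_three_halves[OF t] by (simp add: mult_ac)
  finally show ?thesis unfolding I_def .
qed

lemma sine_coeff_stable_le:
  obtains C where "C > 0"
    "\<And>t n. t > 0 \<Longrightarrow> sine_coeff (\<lambda>s. exp (- t * (1 - g * cos s) powr a)) n
       \<le> C * (real (Suc n) * (t powr (- 3 / 2) * exp (- t * (1 - g) powr a)))"
proof -
  define J where "J = (\<integral>x. x ^ 2 * exp (- rate a g * x\<^sup>2) \<partial>lborel)"
  define d where "d = pi * sqrt (curv a g) ^ 3"
  have c: "curv a g > 0" by (rule curv_pos[OF a g])
  have d: "d > 0" using c by (simp add: d_def)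
  have J: "J \<ge> 0" unfolding J_def by (intro integral_nonneg_AE AE_I2) auto
  show thesis
  proof (rule that)
    show "(J + 1) / d > 0" using J d by simp
    fix t :: real and n :: nat assume t: "t > 0"
    define r where "r = sqrt (t * curv a g)"
    define k where "k = real (Suc n) / r"
    have r: "r > 0" using t c by (simp add: r_def)
    have k: "k > 0" using r by (simp add: k_def)
    define X where "X = real (Suc n) * (t powr (- 3 / 2) * exp (- t * (1 - g) powr a))"
    have X: "X \<ge> 0" by (simp add: X_def)
    have "sine_coeff (\<lambda>s. exp (- t * (1 - g * cos s) powr a)) n = X / d * (\<integral>x. profile a g r x * (sin (k * x) / k) \<partial>lborel)"
      unfolding X_def d_def k_def r_def by (rule sine_coeff_stable_eq[OF t])
    also have "\<dots> \<le> X / d * (J + 1)"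
    proof (rule mult_left_mono)
      show "(\<integral>x. profile a g r x * (sin (k * x) / k) \<partial>lborel) \<le> J + 1"
        using abs_le_D1[OF profile_integral_le[OF a g r k]] unfolding J_def[symmetric] by linarith
    qed (use X d in simp)
    finally show "sine_coeff (\<lambda>s. exp (- t * (1 - g * cos s) powr a)) n \<le> (J + 1) / d * X"
      by (simp add: mult_ac)
  qed
qed

lemma sine_coeff_stable_ge:
  assumes K: "K > 0"
  obtains c t0 where "c > 0"
    "\<And>t n. t > 0 \<Longrightarrow> t \<ge> t0 \<Longrightarrow> real (Suc n) \<le> K * sqrt t \<Longrightarrow>
       c * (real (Suc n) * (t powr (- 3 / 2) * exp (- t * (1 - g) powr a)))
       \<le> sine_coeff (\<lambda>s. exp (- t * (1 - g * cos s) powr a)) n"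
proof -
  define d where "d = pi * sqrt (curv a g) ^ 3"
  have c: "curv a g > 0" by (rule curv_pos[OF a g])
  have d: "d > 0" using c by (simp add: d_def)
  \<comment> \<open>An upper bound for k = (n+1)/r when n + 1 <= K sqrt t; the Gaussian main term is
    then at least m, and r0 keeps the error below m/2.\<close>
  define K1 where "K1 = K / sqrt (curv a g)"
  define m where "m = sqrt (2 * pi) * exp (- K1\<^sup>2 / 2)"
  have m: "m > 0" by (simp add: m_def)
  define err where "err = (\<lambda>r. \<integral>x. \<bar>profile a g r x - x * exp (- x\<^sup>2 / 2)\<bar> * \<bar>x\<bar> \<partial>lborel)"
  have "\<forall>\<^sub>F r in at_top. err r < m / 2"
    using profile_L1_limit[OF a g] m unfolding err_def[symmetric] by (intro order_tendstoD(2)) auto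
  then obtain r0 where r0: "\<And>r. r \<ge> r0 \<Longrightarrow> err r < m / 2"
    by (auto simp: eventually_at_top_linorder)
  show thesis
  proof (rule that)
    show "m / (2 * d) > 0" using m d by simp
    fix t :: real and n :: nat
    assume t: "t > 0" and t0: "t \<ge> r0\<^sup>2 / curv a g" and n: "real (Suc n) \<le> K * sqrt t"
    define r where "r = sqrt (t * curv a g)"
    define k where "k = real (Suc n) / r"
    have r: "r > 0" using t c by (simp add: r_def)
    have k: "k > 0" using r by (simp add: k_def)
    have "r0\<^sup>2 \<le> t * curv a g" using t0 c by (simp add: pos_divide_le_eq)
    then have "r0 \<le> r" unfolding r_def by (rule real_le_rsqrt)
    then have err: "err r < m / 2" by (rule r0)
    have "k \<le> K * sqrt t / r" unfolding k_def using n r by (intro divide_right_mono) auto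
    also have "\<dots> = K1" using t by (simp add: r_def K1_def real_sqrt_mult)
    finally have "k\<^sup>2 \<le> K1\<^sup>2" using k by (intro power_mono) auto
    then have "m \<le> sqrt (2 * pi) * exp (- k\<^sup>2 / 2)"
      unfolding m_def by (intro mult_left_mono) auto
    then have I: "m / 2 \<le> (\<integral>x. profile a g r x * (sin (k * x) / k) \<partial>lborel)"
      using profile_integral_ge[OF a g r k] err unfolding err_def by linarith
    define X where "X = real (Suc n) * (t powr (- 3 / 2) * exp (- t * (1 - g) powr a))"
    have X: "X \<ge> 0" by (simp add: X_def)
    have "m / (2 * d) * X = X / d * (m / 2)" by (simp add: mult_ac)
    also have "\<dots> \<le> X / d * (\<integral>x. profile a g r x * (sin (k * x) / k) \<partial>lborel)"
      using I X d by (intro mult_left_mono) auto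
    also have "\<dots> = sine_coeff (\<lambda>s. exp (- t * (1 - g * cos s) powr a)) n"
      unfolding X_def d_def k_def r_def by (rule sine_coeff_stable_eq[OF t, symmetric])
    finally show "m / (2 * d) * X \<le> sine_coeff (\<lambda>s. exp (- t * (1 - g * cos s) powr a)) n" .
  qed
qed

end

section \<open>Estimates near the root\<close>

text \<open>Instead of summing the differences, the proof uses the majorant h(n) = 2C(n+5)s^n. As
  s^2 <= 1/2, it satisfies C(n+1)s^n + h(n+2) <= h(n), so p(n) - h(n) <= p(n+2N) for all N. Finally
  n + 5 <= 5(n+1) gives the constant 10.\<close>

lemma stable_walk_telescope:
  fixes q :: nat and p S :: "nat \<Rightarrow> real" and C :: real
  assumes q: "q \<ge> 2"
    and diff: "\<And>n. sqrt (real q) ^ n * (p n - p (n + 2)) = S n"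
    and S: "\<And>n. S n \<le> C * real (Suc n)" and C: "C \<ge> 0"
    and lim: "p \<longlonglongrightarrow> 0"
  shows "p n \<le> 10 * C * (real (Suc n) * (1 / sqrt (real q)) ^ n)"
proof -
  define s where "s = 1 / sqrt (real q)"
  have s: "s > 0" "s * s \<le> 1 / 2" using q by (simp_all add: s_def)
  have step: "p n - p (n + 2) = S n * s ^ n" for n
    using diff[of n] q by (simp add: s_def power_one_over field_simps)
  have "p n - 2 * C * real (n + 5) * s ^ n \<le> p (n + 2 * N)" for n N
  proof (induction N arbitrary: n)
    case 0
    then show ?case using C s by simp
  next
    case (Suc N)
    have "S n * s ^ n \<le> C * real (Suc n) * s ^ n"
      using S s by (intro mult_right_mono) auto
    moreover have "2 * C * real (n + 2 + 5) * s ^ (n + 2) \<le> C * real (n + 7) * s ^ n"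
    proof -
      have "s ^ (n + 2) = s ^ n * (s * s)" by (simp add: power_add power2_eq_square)
      also have "\<dots> \<le> s ^ n * (1 / 2)" using s by (intro mult_left_mono) auto
      finally have "2 * C * real (n + 7) * s ^ (n + 2) \<le> 2 * C * real (n + 7) * (s ^ n * (1 / 2))"
        using C by (intro mult_left_mono) auto
      also have "\<dots> = C * real (n + 7) * s ^ n" by simp
      finally show ?thesis by (simp only: add.assoc) simp
    qed
    moreover have "p (n + 2) - 2 * C * real (n + 2 + 5) * s ^ (n + 2) \<le> p (n + 2 * Suc N)"
      using Suc.IH[of "n + 2"] by (simp add: add.assoc)
    moreover have "C * real (Suc n) * s ^ n + C * real (n + 7) * s ^ n \<le> 2 * C * real (n + 5) * s ^ n"
    proof -
      have "C * s ^ n * (real (Suc n) + real (n + 7)) \<le> C * s ^ n * (2 * real (n + 5))"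
        using C s by (intro mult_left_mono) auto
      then show ?thesis by (simp add: algebra_simps)
    qed
    ultimately show ?case using step[of n] by linarith
  qed
  moreover have "(\<lambda>N. p (n + 2 * N)) \<longlonglongrightarrow> 0"
    by (rule filterlim_compose[OF lim]) real_asymp
  ultimately have "p n - 2 * C * real (n + 5) * s ^ n \<le> 0"
    by (intro LIMSEQ_le_const) auto
  moreover have "2 * C * real (n + 5) * s ^ n \<le> 2 * C * (5 * real (Suc n)) * s ^ n"
    using C s by (intro mult_right_mono mult_left_mono) auto
  moreover have "2 * C * (5 * x) * y = 10 * C * (x * y)" for x y :: real by simp
  ultimately have "p n \<le> 10 * C * (real (Suc n) * s ^ n)" by (metis diff_le_0_iff_le order_trans)
  then show ?thesis unfolding s_def .
qed

lemma stable_walk_near: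
  fixes q :: nat and a K :: real
  assumes q: "q \<ge> 2" and a: "0 < a" "a < 1" and K: "K > 0"
  obtains c D where "c > 0" "D > 0"
    "\<And>t B p n. t \<ge> 1 \<Longrightarrow> discrete_stable a t B \<Longrightarrow> (\<And>n. (\<lambda>m. B m * walk q m n) sums p n) \<Longrightarrow>
       real n < K * t powr (1 / 2) \<Longrightarrow>
       c * (phi q n * t powr (- 3 / 2) * exp (- t * (1 - tree_gamma q) powr a)) \<le> p n \<and>
       p n \<le> D * (phi q n * t powr (- 3 / 2) * exp (- t * (1 - tree_gamma q) powr a))"
proof -
  let ?g = "tree_gamma q"
  note g = tree_gamma_bounds[OF q]
  obtain C where C: "C > 0"
    "\<And>t n. t > 0 \<Longrightarrow> sine_coeff (\<lambda>s. exp (- t * (1 - ?g * cos s) powr a)) n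
       \<le> C * (real (Suc n) * (t powr (- 3 / 2) * exp (- t * (1 - ?g) powr a)))"
    using sine_coeff_stable_le[OF a g] by metis
  obtain c1 t0 where c1: "c1 > 0"
    "\<And>t n. t > 0 \<Longrightarrow> t \<ge> t0 \<Longrightarrow> real (Suc n) \<le> (K + 1) * sqrt t \<Longrightarrow>
       c1 * (real (Suc n) * (t powr (- 3 / 2) * exp (- t * (1 - ?g) powr a)))
       \<le> sine_coeff (\<lambda>s. exp (- t * (1 - ?g * cos s) powr a)) n"
    \<comment> \<open>The constant is enlarged by 1 to cover n + 1 in place of n, since sqrt t >=
      1.\<close>
    using sine_coeff_stable_ge[OF a g, of "K + 1"] K by (metis add_pos_pos zero_less_one)
  \<comment> \<open>Laplace's method is effective for t >= \<tau>. For 1 <= t < \<tau> the region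
    contains only distances n <= N, where the single term m = n of the series is bounded
    below.\<close>
  define \<tau> where "\<tau> = max 1 t0"
  have \<tau>: "\<tau> > 0" by (simp add: \<tau>_def)
  obtain b where b: "b > 0"
    "\<And>t B m. 0 < t \<Longrightarrow> discrete_stable a t B \<Longrightarrow> m \<ge> 1 \<Longrightarrow> t * real m powr (- a) \<le> \<tau> \<Longrightarrow>
      b * t * real m powr (- 1 - a) \<le> B m"
    using discrete_stable_ge[OF a \<tau>] by metis
  define N where "N = nat \<lceil>K * sqrt \<tau>\<rceil> + 1"
  \<comment> \<open>The first entry treats n = 0, where B 0 = exp(-t); the power bound on B requires
    n >= 1.\<close>
  define b' where "b' = min (exp (- \<tau>)) (b * real N powr (- 1 - a))"
  have b': "b' > 0" using b by (simp add: b'_def N_def)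
  define w where "w = Min ((\<lambda>n. walk q n n) ` {..N})"
  have w: "w > 0" unfolding w_def by (subst Min_gr_iff) (auto simp: walk_diag_pos)
  define c2 where "c2 = b' * w / real (Suc N)"
  have c2: "c2 > 0" using b' w by (simp add: c2_def)
  show thesis
  proof (rule that)
    show "min c1 c2 > 0" using c1 c2 by simp
    show "30 * C > 0" using C by simp
    fix t B p n
    assume t: "t \<ge> (1 :: real)" and B: "discrete_stable a t B"
      and p: "\<And>n. (\<lambda>m. B m * walk q m n) sums p n" and n: "real n < K * t powr (1 / 2)"
    have t0: "t > 0" using t by simp
    note nonneg = discrete_stable_nonneg[OF a t0 B]
    define X where "X = t powr (- 3 / 2) * exp (- t * (1 - ?g) powr a)"
    have X: "X > 0" using t0 by (simp add: X_def)
    note diff = stable_walk_diff_eq[OF q a t0 B p]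
    have p0: "p n \<ge> 0" for n
      using sums_le[OF _ sums_zero p[of n]] nonneg walk_nonneg by simp
    have p_le: "p n \<le> 2 * (1 / real q) ^ n" for n
    proof (rule sums_le[OF _ p])
      show "(\<lambda>m. B m * (2 * (1 / real q) ^ n)) sums (2 * (1 / real q) ^ n)"
        using sums_mult2[OF discrete_stable_sums[OF B, of 1]] by simp
      show "B m * walk q m n \<le> B m * (2 * (1 / real q) ^ n)" for m
        by (intro mult_left_mono walk_le q nonneg)
    qed
    have "p \<longlonglongrightarrow> 0"
    proof (rule tendsto_sandwich[OF _ _ tendsto_const])
      have "(\<lambda>n. (1 / real q) ^ n) \<longlonglongrightarrow> 0"
        using q by (intro LIMSEQ_power_zero) auto
      then show "(\<lambda>n. 2 * (1 / real q) ^ n) \<longlonglongrightarrow> 0"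
        using tendsto_mult_right_zero by blast
    qed (auto simp: p0 p_le)
    moreover have "sine_coeff (\<lambda>s. exp (- t * (1 - ?g * cos s) powr a)) n \<le> C * X * real (Suc n)" for n
      using C(2)[OF t0, of n] by (simp add: X_def mult_ac)
    ultimately have "p n \<le> 10 * (C * X) * (real (Suc n) * (1 / sqrt (real q)) ^ n)"
      using C X by (intro stable_walk_telescope[OF q diff]) auto
    also have "\<dots> \<le> 10 * (C * X) * (3 * phi q n)"
      using C X by (intro mult_left_mono phi_ge q) auto
    finally have upper: "p n \<le> 30 * C * (phi q n * X)" by (simp add: mult_ac)
    have lower: "min c1 c2 * (phi q n * X) \<le> p n"
    proof (cases "t \<ge> \<tau>")
      case True
      have "sqrt t \<ge> 1" using t by simp
      moreover have "real n < K * sqrt t" using n t0 by (simp add: powr_half_sqrt)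
      ultimately have "real (Suc n) \<le> (K + 1) * sqrt t"
        unfolding distrib_right of_nat_Suc mult_1 by linarith
      then have "c1 * (real (Suc n) * X) \<le> sine_coeff (\<lambda>s. exp (- t * (1 - ?g * cos s) powr a)) n"
        unfolding X_def using True t0 by (intro c1) (auto simp: \<tau>_def)
      also have "\<dots> = sqrt (real q) ^ n * (p n - p (n + 2))"
        by (rule diff[symmetric])
      \<comment> \<open>The lower bound requires no telescoping: p (n + 2) >= 0 is simply
        dropped.\<close>
      also have "\<dots> \<le> sqrt (real q) ^ n * p n"
        using p0[of "n + 2"] by (intro mult_left_mono) auto
      finally have "c1 * X * (real (Suc n) * (1 / sqrt (real q)) ^ n) \<le> p n"
        using q by (simp add: power_one_over pos_divide_le_eq mult_ac)
      moreover have "c1 * X * phi q n \<le> c1 * X * (real (Suc n) * (1 / sqrt (real q)) ^ n)"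
        using c1 X by (intro mult_left_mono phi_le) auto
      moreover have "min c1 c2 * (phi q n * X) \<le> c1 * (phi q n * X)"
        using phi_pos[OF q, of n] X by (intro mult_right_mono) auto
      ultimately show ?thesis by (simp add: mult_ac)
    next
      case False
      then have "sqrt t \<le> sqrt \<tau>" by simp
      then have "K * sqrt t \<le> K * sqrt \<tau>" using K by (intro mult_left_mono) auto
      then have "real n \<le> real N"
        using n t0 unfolding N_def by (simp add: powr_half_sqrt) linarith
      then have nN: "n \<le> N" by simp
      have "b' \<le> B n"
      proof (cases "n = 0")
        case True
        have "exp (- \<tau>) \<le> B n" using False True discrete_stable_0[OF B] by simp
        then show ?thesis unfolding b'_def by (rule min.coboundedI1)
      next
        case n0: False
        have "real n powr (- a) \<le> real n powr 0"
          using n0 a by (intro powr_mono) auto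
        then have "t * real n powr (- a) \<le> \<tau> * 1"
          using False n0 t0 by (intro mult_mono) auto
        then have "b * t * real n powr (- 1 - a) \<le> B n"
          using n0 t0 B by (intro b) auto
        moreover have "b * real N powr (- 1 - a) \<le> b * real n powr (- 1 - a)"
          using b n0 nN a by (intro mult_left_mono powr_mono2') auto
        moreover have "1 * (b * real n powr (- 1 - a)) \<le> t * (b * real n powr (- 1 - a))"
          using t b by (intro mult_right_mono) auto
        ultimately have "b * real N powr (- 1 - a) \<le> B n" by (simp add: mult_ac)
        then show ?thesis unfolding b'_def by (rule min.coboundedI2)
      qed
      moreover have "w \<le> walk q n n"
        unfolding w_def using nN by (intro Min_le) auto
      ultimately have "b' * w \<le> B n * walk q n n"
        using b' w nonneg by (intro mult_mono) auto
      also have "\<dots> \<le> p n"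
        using sum_le_suminf[OF sums_summable[OF p[of n]], of "{n}"] nonneg walk_nonneg
        by (simp add: sums_unique[OF p[of n]])
      finally have 1: "b' * w \<le> p n" .
      have "(1 - ?g) powr a \<ge> 0" by simp
      then have "exp (- t * (1 - ?g) powr a) \<le> 1" using t0 by simp
      moreover have "t powr (- 3 / 2) \<le> 1"
        using t powr_mono[of "- 3 / 2" 0 t] by simp
      ultimately have "X \<le> 1" unfolding X_def using mult_le_one by force
      moreover have "phi q n \<le> real (Suc N)"
      proof -
        have "(1 / sqrt (real q)) ^ n \<le> 1" using q by (intro power_le_one) auto
        then have "real (Suc n) * (1 / sqrt (real q)) ^ n \<le> real (Suc N) * 1"
          using nN q by (intro mult_mono) auto
        from order_trans[OF phi_le this] show ?thesis by simp
      qed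
      ultimately have "phi q n * X \<le> real (Suc N) * 1"
        using X phi_pos[OF q, of n] by (intro mult_mono) auto
      then have "c2 * (phi q n * X) \<le> c2 * real (Suc N)"
        using c2 by (intro mult_left_mono) auto
      also have "\<dots> = b' * w" by (simp add: c2_def)
      finally have "c2 * (phi q n * X) \<le> p n" using 1 by linarith
      moreover have "min c1 c2 * (phi q n * X) \<le> c2 * (phi q n * X)"
        using phi_pos[OF q, of n] X by (intro mult_right_mono) auto
      ultimately show ?thesis by linarith
    qed
    show "min c1 c2 * (phi q n * t powr (- 3 / 2) * exp (- t * (1 - ?g) powr a)) \<le> p n \<and>
       p n \<le> 30 * C * (phi q n * t powr (- 3 / 2) * exp (- t * (1 - ?g) powr a))"
      using lower upper by (simp add: X_def mult.assoc)
  qed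
qed

section \<open>Comparison of the kernels\<close>

lemma comparable_onI:
  assumes "c > 0" "D > 0" and "\<And>z. z \<in> R \<Longrightarrow> 0 < g z \<and> c * g z \<le> f z \<and> f z \<le> D * g z"
  shows "comparable_on R f g"
  unfolding comparable_on_def
proof (intro exI conjI ballI)
  define k where "k = 1 / c + D + 1"
  have "1 / c > 0" using assms by simp
  then show k: "k > 0" using assms(2) unfolding k_def by linarith
  have "1 / c < k" using assms(2) unfolding k_def by linarith
  then have "inverse k < c"
    using assms k by (simp add: field_simps)
  fix z assume "z \<in> R"
  note z = assms(3)[OF this]
  have "c \<le> f z / g z" "f z / g z \<le> D" using z by (auto simp: field_simps)
  moreover have "D < k" using \<open>1 / c > 0\<close> unfolding k_def by linarith
  ultimately show "inverse k < f z / g z" "f z / g z < k"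
    using \<open>inverse k < c\<close> by linarith+
qed

lemma sqrt_powr_half: "q \<ge> 2 \<Longrightarrow> real q powr (- real n / 2) = (1 / sqrt (real q)) ^ n"
proof -
  assume q: "q \<ge> 2"
  have "real q powr (- real n / 2) = (real q powr (- (1 / 2))) powr real n"
    by (simp add: powr_powr)
  also have "\<dots> = (1 / sqrt (real q)) powr real n"
    using q by (simp add: powr_minus_divide powr_half_sqrt)
  also have "\<dots> = (1 / sqrt (real q)) ^ n"
    using q by (intro powr_realpow) simp
  finally show ?thesis .
qed

lemma spherical0_eq: "q \<ge> 2 \<Longrightarrow> spherical0 q E x0 x = phi q (graph_dist E x0 x)"
  unfolding spherical0_def phi_def by (simp only: sqrt_powr_half)

theorem theorem3p1:
  fixes q :: nat and E :: "'a \<Rightarrow> 'a \<Rightarrow> bool" and x0 :: 'a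
    and \<alpha> K M :: real and \<eta> :: "real \<Rightarrow> real \<Rightarrow> real"
  assumes "q \<ge> 2" and "homogeneous_tree q E"
    and "0 < \<alpha>" and "\<alpha> < 2"
    and "\<And>t. t > 0 \<Longrightarrow> stable_density \<alpha> t (\<eta> t)"
    and "K > 0" and "M > 0"
  shows
    "comparable_on
       {(t, x). t \<ge> 1 \<and> real (graph_dist E x0 x) < K * t powr (1 / 2)}
       (\<lambda>(t, x). stable_kernel q E x0 \<eta> t x)
       (\<lambda>(t, x). spherical0 q E x0 x * t powr (- 3 / 2)
                  * exp (- t * (1 - tree_gamma q) powr (\<alpha> / 2)))
     \<and>
     comparable_on
       {(t, x). t > 0 \<and> real (graph_dist E x0 x) > M * t powr (2 / \<alpha>)}
       (\<lambda>(t, x). stable_kernel q E x0 \<eta> t x)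
       (\<lambda>(t, x). spherical0 q E x0 x * t
                  * real (graph_dist E x0 x) powr (- 2 - \<alpha> / 2)
                  * real q powr (- real (graph_dist E x0 x) / 2))"
proof
  note q = assms(1)
  define a where "a = \<alpha> / 2"
  have a: "0 < a" "a < 1" using assms by (simp_all add: a_def)
  define d where "d = graph_dist E x0"
  define B where "B = (\<lambda>t. poisson_mix (\<eta> t))"
  define p where "p = (\<lambda>t n. \<Sum>m. B t m * walk q m n)"
  have B: "discrete_stable a t (B t)" if "t > 0" for t
    unfolding a_def B_def by (rule discrete_stable_poisson_mix[OF assms(5)[OF that]])
  have p: "(\<lambda>m. B t m * walk q m n) sums p t n" if t: "t > 0" for t n
  proof -
    have "summable (\<lambda>m. B t m * walk q m n)"
    proof (rule summable_comparison_test)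
      show "summable (B t)" using discrete_stable_sums[OF B[OF t], of 1] by (simp add: sums_iff)
      have "norm (B t m * walk q m n) \<le> B t m" for m
        using discrete_stable_nonneg[OF a t B[OF t], of m] walk_nonneg[of q m n] walk_le_1[of q m n]
        by (simp add: abs_mult mult_left_le)
      then show "\<exists>N. \<forall>m\<ge>N. norm (B t m * walk q m n) \<le> B t m" by blast
    qed
    then show ?thesis unfolding p_def by (rule summable_sums)
  qed
  have kernel: "stable_kernel q E x0 \<eta> t x = p t (d x)" if "t > 0" for t x
    using stable_kernel_sums[where t=t and \<eta>=\<eta>, OF assms(2) assms(5)[OF that], of x0 x] sums_unique2[OF p[OF that]]
    by (auto simp: B_def d_def)
  show "comparable_on {(t, x). t \<ge> 1 \<and> real (graph_dist E x0 x) < K * t powr (1 / 2)}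
     (\<lambda>(t, x). stable_kernel q E x0 \<eta> t x)
     (\<lambda>(t, x). spherical0 q E x0 x * t powr (- 3 / 2) * exp (- t * (1 - tree_gamma q) powr (\<alpha> / 2)))"
  proof -
    obtain c D where cD: "c > 0" "D > 0"
      "\<And>t B p n. t \<ge> 1 \<Longrightarrow> discrete_stable a t B \<Longrightarrow> (\<And>n. (\<lambda>m. B m * walk q m n) sums p n) \<Longrightarrow>
       real n < K * t powr (1 / 2) \<Longrightarrow>
       c * (phi q n * t powr (- 3 / 2) * exp (- t * (1 - tree_gamma q) powr a)) \<le> p n \<and>
       p n \<le> D * (phi q n * t powr (- 3 / 2) * exp (- t * (1 - tree_gamma q) powr a))"
      using stable_walk_near[OF q a assms(6)] by blast
    show ?thesis
    proof (rule comparable_onI[OF cD(1,2)], clarify)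
      fix t x assume t: "t \<ge> (1 :: real)" and x: "real (graph_dist E x0 x) < K * t powr (1 / 2)"
      have t0: "t > 0" using t by simp
      show "0 < spherical0 q E x0 x * t powr (- 3 / 2) * exp (- t * (1 - tree_gamma q) powr (\<alpha> / 2)) \<and>
        c * (spherical0 q E x0 x * t powr (- 3 / 2) * exp (- t * (1 - tree_gamma q) powr (\<alpha> / 2))) \<le> stable_kernel q E x0 \<eta> t x \<and>
        stable_kernel q E x0 \<eta> t x \<le> D * (spherical0 q E x0 x * t powr (- 3 / 2) * exp (- t * (1 - tree_gamma q) powr (\<alpha> / 2)))"
        using cD(3)[OF t B[OF t0] p[OF t0] x] phi_pos[OF q, of "d x"] t0
        unfolding spherical0_eq[OF q] kernel[OF t0] d_def[symmetric] a_def[symmetric] by simp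
    qed
  qed
  show "comparable_on {(t, x). t > 0 \<and> real (graph_dist E x0 x) > M * t powr (2 / \<alpha>)}
     (\<lambda>(t, x). stable_kernel q E x0 \<eta> t x)
     (\<lambda>(t, x). spherical0 q E x0 x * t * real (graph_dist E x0 x) powr (- 2 - \<alpha> / 2)
        * real q powr (- real (graph_dist E x0 x) / 2))"
  proof -
    obtain c D where cD: "c > 0" "D > 0"
      "\<And>t B n p. t > 0 \<Longrightarrow> discrete_stable a t B \<Longrightarrow> real n > M * t powr (1 / a) \<Longrightarrow>
       (\<lambda>m. B m * walk q m n) sums p \<Longrightarrow>
       c * (t * real n powr (- 1 - a) * (1 / real q) ^ n) \<le> p \<and>
       p \<le> D * (t * real n powr (- 1 - a) * (1 / real q) ^ n)"
      using stable_walk_far[OF q a assms(7)] by blast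
    have "c / 2 > 0" "3 * D > 0" using cD by simp_all
    then show ?thesis
    proof (rule comparable_onI, clarify)
      fix t x assume t: "t > (0 :: real)" and x: "real (graph_dist E x0 x) > M * t powr (2 / \<alpha>)"
      define n where "n = d x"
      have x': "real n > M * t powr (1 / a)" using x by (simp add: n_def d_def a_def)
      have n: "n \<ge> 1"
      proof -
        have "M * t powr (1 / a) \<ge> 0" using assms(7) by simp
        then show ?thesis using x' by linarith
      qed
      define Y where "Y = t * real n powr (- 1 - a) * (1 / real q) ^ n"
      have Y: "Y > 0" using t n q by (simp add: Y_def)
      define h where "h = spherical0 q E x0 x * t * real n powr (- 2 - a) * real q powr (- real n / 2)"
      \<comment> \<open>The quotient of the claimed bound and Y. It lies between 1/3 and 2 for n >=
        1 and q >= 2, which accounts for the constants c/2 and 3D.\<close>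
      define \<rho> where "\<rho> = (1 + (real q - 1) / (real q + 1) * real n) / real n"
      have "h = \<rho> * Y"
      proof -
        have "real n powr (- 2 - a) = real n powr (- 1 - a) / real n"
        proof -
          have "- 2 - a = (- 1 - a) - 1" by simp
          then show ?thesis using n by (simp only: powr_diff) simp
        qed
        moreover have "(1 / sqrt (real q)) ^ n * (1 / sqrt (real q)) ^ n = (1 / real q) ^ n"
          by (simp add: power_mult_distrib[symmetric])
        ultimately show ?thesis
          unfolding h_def Y_def \<rho>_def spherical0_eq[OF q] phi_def sqrt_powr_half[OF q] d_def[symmetric] n_def[symmetric]
          by (simp add: mult_ac)
      qed
      define y where "y = (real q - 1) / (real q + 1) * real n"
      have "1 / 3 * real n \<le> y" "y \<le> 1 * real n"
        unfolding y_def using q by (intro mult_right_mono; simp add: le_divide_eq)+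
      then have \<rho>1: "\<rho> \<le> 2" and \<rho>2: "1 / 3 \<le> \<rho>"
        unfolding \<rho>_def y_def[symmetric] using n by (simp_all add: le_divide_eq divide_le_eq)
      have main: "c * Y \<le> p t n" "p t n \<le> D * Y"
        using cD(3)[OF t B[OF t] x' p[OF t]] by (simp_all add: Y_def)
      have "0 < h" using \<rho>2 Y by (simp add: \<open>h = \<rho> * Y\<close>)
      moreover have "c / 2 * h \<le> p t n"
      proof -
        have "c / 2 * \<rho> * Y \<le> c / 2 * 2 * Y"
          using \<rho>1 cD Y by (intro mult_right_mono mult_left_mono) auto
        then show ?thesis using main by (simp add: \<open>h = \<rho> * Y\<close>)
      qed
      moreover have "p t n \<le> 3 * D * h"
      proof -
        have "3 * D * (1 / 3) * Y \<le> 3 * D * \<rho> * Y"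
          using \<rho>2 cD Y by (intro mult_right_mono mult_left_mono) auto
        then show ?thesis using main by (simp add: \<open>h = \<rho> * Y\<close>)
      qed
      ultimately show "0 < spherical0 q E x0 x * t * real (graph_dist E x0 x) powr (- 2 - \<alpha> / 2) * real q powr (- real (graph_dist E x0 x) / 2) \<and>
        c / 2 * (spherical0 q E x0 x * t * real (graph_dist E x0 x) powr (- 2 - \<alpha> / 2) * real q powr (- real (graph_dist E x0 x) / 2)) \<le> stable_kernel q E x0 \<eta> t x \<and>
        stable_kernel q E x0 \<eta> t x \<le> 3 * D * (spherical0 q E x0 x * t * real (graph_dist E x0 x) powr (- 2 - \<alpha> / 2) * real q powr (- real (graph_dist E x0 x) / 2))"
        unfolding kernel[OF t] d_def[symmetric] n_def[symmetric] a_def[symmetric] h_def[symmetric] by simp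
    qed
  qed
qed

end
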